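(* Let $G=(V,E)$ be a DAG, $\Sigma$ a finite alphabet with $\sigma=|\Sigma|$, $\ell:V\to\Sigma$ a labeling function and $S\in\Sigma^m$ a string. One can decide whether $S$ has a match in $G,\ell$ in time $O((|V|+|E|)k+\sigma m)$, where $k=\min\left(\max_{v\in V}\mu_s(v),\max_{v\in V}\mu_t(v)\right)$.
   Context: A path is a sequence $v_1,\dots,v_p$ of distinct vertices with $(v_i,v_{i+1})\in E$ for all $i$; a single vertex is a path. The label of a path $P=v_1,\dots,v_p$ is $\ell(P)=\ell(v_1)\cdots\ell(v_p)$. $S$ has a match in $G,\ell$ if some path $P$ of $G$ satisfies $\ell(P)=S$. A source is a vertex of in-degree $0$, a sink a vertex of out-degree $0$. For $v\in V$, $\mu_s(v)$ is the number of paths from a source of $G$ to $v$, and $\mu_t(v)$ is the number of paths from $v$ to a sink of $G$ (so $\mu_s(v)=1$ for a source $v$ and $\mu_t(v)=1$ for a sink $v$). *)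

theory Defs
  imports Main
begin

definition dag :: "'v set \<Rightarrow> ('v \<times> 'v) set \<Rightarrow> bool" where
  "dag V E \<longleftrightarrow> finite V \<and> E \<subseteq> V \<times> V \<and> acyclic E"

definition is_path :: "'v set \<Rightarrow> ('v \<times> 'v) set \<Rightarrow> 'v list \<Rightarrow> bool" where
  "is_path V E p \<longleftrightarrow>
     p \<noteq> [] \<and> distinct p \<and> set p \<subseteq> V \<and> (\<forall>i. Suc i < length p \<longrightarrow> (p ! i, p ! Suc i) \<in> E)"

definition path_label :: "('v \<Rightarrow> 'a) \<Rightarrow> 'v list \<Rightarrow> 'a list" where
  "path_label lab p = map lab p"

definition has_match :: "'v set \<Rightarrow> ('v \<times> 'v) set \<Rightarrow> ('v \<Rightarrow> 'a) \<Rightarrow> 'a list \<Rightarrow> bool" where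
  "has_match V E lab S \<longleftrightarrow> (\<exists>p. is_path V E p \<and> path_label lab p = S)"

definition in_degree :: "('v \<times> 'v) set \<Rightarrow> 'v \<Rightarrow> nat" where
  "in_degree E v = card {u. (u, v) \<in> E}"

definition out_degree :: "('v \<times> 'v) set \<Rightarrow> 'v \<Rightarrow> nat" where
  "out_degree E v = card {u. (v, u) \<in> E}"

definition is_source :: "'v set \<Rightarrow> ('v \<times> 'v) set \<Rightarrow> 'v \<Rightarrow> bool" where
  "is_source V E v \<longleftrightarrow> v \<in> V \<and> in_degree E v = 0"

definition is_sink :: "'v set \<Rightarrow> ('v \<times> 'v) set \<Rightarrow> 'v \<Rightarrow> bool" where
  "is_sink V E v \<longleftrightarrow> v \<in> V \<and> out_degree E v = 0"

definition mu_s :: "'v set \<Rightarrow> ('v \<times> 'v) set \<Rightarrow> 'v \<Rightarrow> nat" where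
  "mu_s V E v = card {p. is_path V E p \<and> is_source V E (hd p) \<and> last p = v}"

definition mu_t :: "'v set \<Rightarrow> ('v \<times> 'v) set \<Rightarrow> 'v \<Rightarrow> nat" where
  "mu_t V E v = card {p. is_path V E p \<and> hd p = v \<and> is_sink V E (last p)}"

definition min_max_mu :: "'v set \<Rightarrow> ('v \<times> 'v) set \<Rightarrow> nat" where
  "min_max_mu V E = min (Max (mu_s V E ` V)) (Max (mu_t V E ` V))"

text \<open>
  The machine model is the unit-cost word RAM: a fixed program works on registers and a
  random-access memory, both holding words of \<open>w\<close> bits, and every instruction takes one time
  step. The only arithmetic is addition (modulo \<open>2 ^ w\<close>) and truncated subtraction.
\<close>

datatype instr =
    LoadConst nat nat
  | Add nat nat nat
  | Sub nat nat nat
  | Load nat nat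
  | Store nat nat
  | Jump nat
  | JumpZero nat nat

type_synonym program = "instr list"

text \<open>A configuration consists of the program counter, the registers and the memory.\<close>

type_synonym config = "nat \<times> (nat \<Rightarrow> nat) \<times> (nat \<Rightarrow> nat)"

fun exec_instr :: "nat \<Rightarrow> instr \<Rightarrow> config \<Rightarrow> config" where
  "exec_instr w (LoadConst r k) (pc, R, M) = (Suc pc, R(r := k mod 2 ^ w), M)"
| "exec_instr w (Add r a b) (pc, R, M) = (Suc pc, R(r := (R a + R b) mod 2 ^ w), M)"
| "exec_instr w (Sub r a b) (pc, R, M) = (Suc pc, R(r := R a - R b), M)"
| "exec_instr w (Load r a) (pc, R, M) = (Suc pc, R(r := M (R a)), M)"
| "exec_instr w (Store a r) (pc, R, M) = (Suc pc, R, M(R a := R r))"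
| "exec_instr w (Jump j) (pc, R, M) = (j, R, M)"
| "exec_instr w (JumpZero r j) (pc, R, M) = (if R r = 0 then j else Suc pc, R, M)"

definition halted :: "program \<Rightarrow> config \<Rightarrow> bool" where
  "halted P cfg \<longleftrightarrow> length P \<le> fst cfg"

definition step :: "nat \<Rightarrow> program \<Rightarrow> config \<Rightarrow> config" where
  "step w P cfg = (if halted P cfg then cfg else exec_instr w (P ! fst cfg) cfg)"

definition init_config :: "nat list \<Rightarrow> config" where
  "init_config xs = (0, \<lambda>_. 0, \<lambda>i. if i < length xs then xs ! i else 0)"

text \<open>The answer of a halted computation is read off register \<open>0\<close>.\<close>

definition decides_within :: "nat \<Rightarrow> program \<Rightarrow> nat list \<Rightarrow> nat \<Rightarrow> bool \<Rightarrow> bool" where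
  "decides_within w P xs T b \<longleftrightarrow>
     (\<exists>t\<le>T. \<exists>pc R M. (step w P ^^ t) (init_config xs) = (pc, R, M) \<and>
        halted P (pc, R, M) \<and> R 0 = (if b then 1 else 0))"

definition index_in :: "'x list \<Rightarrow> 'x \<Rightarrow> nat" where
  "index_in xs x = length (takeWhile (\<lambda>y. y \<noteq> x) xs)"

text \<open>
  A problem instance is presented to the machine through enumerations of its vertices, edges and
  symbols: a header with the four sizes, the label of each vertex, the list of edges as pairs of
  vertex numbers, and the string. Vertices and symbols are represented by their positions in the
  enumerations.
\<close>

definition encode_instance ::
  "'v list \<Rightarrow> ('v \<times> 'v) list \<Rightarrow> 'a list \<Rightarrow> ('v \<Rightarrow> 'a) \<Rightarrow> 'a list \<Rightarrow> nat list" where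
  "encode_instance vs es as lab S =
     [length vs, length es, length as, length S]
     @ map (\<lambda>v. index_in as (lab v)) vs
     @ concat (map (\<lambda>(u, v). [index_in vs u, index_in vs v]) es)
     @ map (index_in as) S"

end

theory Submission
  imports Defs "HOL-Library.Sublist"
begin

text \<open>
  Extend every path of \<open>G\<close> backwards to a source: \<open>S\<close> has a match iff the Knuth-Morris-Pratt
  automaton of \<open>S\<close>, fed with the labels along some path that starts in a source, reaches its
  accepting state. A depth-first search without any marking of vertices visits every path from a
  source exactly once, that is, it visits the vertex \<open>v\<close> exactly \<open>\<mu>\<^sub>s(v)\<close> times, and the state of the
  automaton is updated in constant time with the help of a transition table of size \<open>\<sigma> m\<close>. Its
  stack only records the current path, so the memory requirement stays polynomial even if the
  numbers \<open>\<mu>\<^sub>s(v)\<close> are not. The same search on the reversed graph with the reversed string visits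
  \<open>v\<close> exactly \<open>\<mu>\<^sub>t(v)\<close> times. Running both searches in lockstep and stopping as soon as one of
  them is finished yields the minimum of the two bounds without computing any \<open>\<mu>\<close>. The empty
  string has no match, because paths are nonempty.
\<close>

section \<open>Structured programs for the word RAM\<close>

text \<open>The number of visits may exceed every machine word, since \<open>2 ^ w\<close> is only
  required to exceed a fixed power of the instance size. Time is therefore charged to a potential
  that exists in the proof alone: twice the number of paths still to be explored plus the number of
  open frames. Initially this is about twice the number of paths that begin in a source; sorting
  these by their last vertex gives the sum of the \<open>mu_s\<close>, at most \<open>card V\<close>
  times their maximum. Edges cost nothing extra in the search, because each edge followed there
  extends the current path to a new one; they are paid for when the input is read. A round of the
  two interleaved searches lowers both potentials and hence their minimum, so the smaller side
  bounds the number of rounds. Without a multiplication instruction, addresses have to come from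
  repeated addition, which dictates the layout of the arrays and of the transition table.\<close>

datatype reg = One | NumV | NumE | Sig | Len | Acc | Run | Res | Cnt | Idx | Ptr | Tmp
  | Src | Dst | Row | Bord | Inner | Sym | VertU | VertV | Edge | State | Pos
  | Root bool | Top bool

text \<open>The Boolean index selects the search: \<open>False\<close> for the given graph and
  string, \<open>True\<close> for the reversed ones.\<close>

datatype arr = Head bool | Next bool | Tgt bool | Str bool | Tab bool | StkE bool | StkQ bool

fun reg_no :: "reg \<Rightarrow> nat" where
  "reg_no One = 3" | "reg_no NumV = 4" | "reg_no NumE = 5" | "reg_no Sig = 6" | "reg_no Len = 7"
| "reg_no Acc = 8" | "reg_no Run = 9" | "reg_no Res = 10" | "reg_no Cnt = 11" | "reg_no Idx = 12"
| "reg_no Ptr = 13" | "reg_no Tmp = 14" | "reg_no Src = 15" | "reg_no Dst = 16" | "reg_no Row = 17"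
| "reg_no Bord = 18" | "reg_no Inner = 19" | "reg_no Sym = 20" | "reg_no VertU = 21"
| "reg_no VertV = 22" | "reg_no Edge = 23" | "reg_no State = 24" | "reg_no Pos = 25"
| "reg_no (Root d) = (if d then 26 else 27)" | "reg_no (Top d) = (if d then 28 else 29)"

fun arr_no :: "arr \<Rightarrow> nat" where
  "arr_no (Head d) = (if d then 0 else 1)" | "arr_no (Next d) = (if d then 2 else 3)"
| "arr_no (Tgt d) = (if d then 4 else 5)" | "arr_no (Str d) = (if d then 6 else 7)"
| "arr_no (Tab d) = (if d then 8 else 9)" | "arr_no (StkE d) = (if d then 10 else 11)"
| "arr_no (StkQ d) = (if d then 12 else 13)"

lemma reg_no_eq_iff [simp]: "reg_no x = reg_no y \<longleftrightarrow> x = y"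
  by (cases x; cases y; simp)

lemma reg_no_ge: "3 \<le> reg_no x"
  by (cases x) auto

lemma reg_no_neq [simp]: "reg_no x \<noteq> 0" "reg_no x \<noteq> Suc 0" "reg_no x \<noteq> 2"
  "0 \<noteq> reg_no x" "Suc 0 \<noteq> reg_no x" "2 \<noteq> reg_no x"
  using reg_no_ge[of x] by auto

lemma arr_no_eq_iff [simp]: "arr_no a = arr_no b \<longleftrightarrow> a = b"
  by (cases a; cases b; simp)

text \<open>Fourteen arrays share a stride of 16, a power of two, so that scaling an index takes
  four doublings.\<close>

lemma arr_no_less: "arr_no a < 16"
  by (cases a) auto

datatype com =
    Skip
  | Const reg nat
  | Plus reg reg reg
  | Minus reg reg reg
  | Input reg reg
  | Read reg arr reg
  | Write arr reg reg
  | Seq com com (infixr ";;" 60)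
  | IfNZ reg com com
  | While reg com

text \<open>
  Register 2 holds the length \<open>L\<close> of the input, and cell \<open>i\<close> of the array with number \<open>k < 16\<close>
  resides at address \<open>L + 16 i + k\<close>; interleaving makes the arrays disjoint without any bound
  on their sizes. Registers 0 and 1 are scratch space for address computations.
\<close>

definition address_code :: "arr \<Rightarrow> reg \<Rightarrow> program" where
  "address_code a y = [LoadConst 1 (arr_no a), Add 0 (reg_no y) (reg_no y), Add 0 0 0, Add 0 0 0,
     Add 0 0 0, Add 0 0 1, Add 0 0 2]"

fun compile :: "com \<Rightarrow> nat \<Rightarrow> program" where
  "compile Skip pc = []"
| "compile (Const x k) pc = [LoadConst (reg_no x) k]"
| "compile (Plus x y z) pc = [Add (reg_no x) (reg_no y) (reg_no z)]"
| "compile (Minus x y z) pc = [Sub (reg_no x) (reg_no y) (reg_no z)]"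
| "compile (Input x y) pc = [Load (reg_no x) (reg_no y)]"
| "compile (Read x a y) pc = address_code a y @ [Load (reg_no x) 0]"
| "compile (Write a y x) pc = address_code a y @ [Store 0 (reg_no x)]"
| "compile (Seq c d) pc =
     (let cs = compile c pc in cs @ compile d (pc + length cs))"
| "compile (IfNZ x c d) pc =
     (let cs = compile c (Suc pc); pc' = pc + length cs + 2; ds = compile d pc'
      in JumpZero (reg_no x) pc' # cs @ Jump (pc' + length ds) # ds)"
| "compile (While x c) pc =
     (let cs = compile c (Suc pc)
      in JumpZero (reg_no x) (pc + length cs + 2) # cs @ [Jump pc])"

section \<open>Timed correctness statements for compiled code\<close>

type_synonym regs = "reg \<Rightarrow> nat"
type_synonym arrs = "arr \<Rightarrow> nat \<Rightarrow> nat"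

text \<open>Registers 0 and 1 are unconstrained, so address computations may overwrite them. The
  input cells are kept intact, which lets the search read vertex labels directly from the
  input.\<close>

definition represents :: "nat list \<Rightarrow> regs \<Rightarrow> arrs \<Rightarrow> (nat \<Rightarrow> nat) \<Rightarrow> (nat \<Rightarrow> nat) \<Rightarrow> bool" where
  "represents xs R A R' M \<longleftrightarrow> R' 2 = length xs \<and> (\<forall>x. R' (reg_no x) = R x) \<and>
     (\<forall>i<length xs. M i = xs ! i) \<and> (\<forall>a i. M (length xs + 16 * i + arr_no a) = A a i)"

text \<open>Jump targets are absolute, so compiled code depends on its position; the quantification
  over \<open>pre\<close> and \<open>post\<close> makes the statement usable wherever the code is
  placed. It asserts total correctness within \<open>T\<close> steps.\<close>

definition runs :: "nat \<Rightarrow> nat list \<Rightarrow> com \<Rightarrow> regs \<Rightarrow> arrs \<Rightarrow> nat \<Rightarrow> (regs \<Rightarrow> arrs \<Rightarrow> bool) \<Rightarrow> bool" where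
  "runs w xs c R A T Q \<longleftrightarrow> (\<forall>pre post R' M'. represents xs R A R' M' \<longrightarrow>
     (\<exists>t\<le>T. \<exists>R1 A1 R1' M1'.
        (step w (pre @ compile c (length pre) @ post) ^^ t) (length pre, R', M') =
          (length pre + length (compile c (length pre)), R1', M1') \<and>
        represents xs R1 A1 R1' M1' \<and> Q R1 A1))"

lemma runsI:
  assumes "\<And>pre post R' M'. represents xs R A R' M' \<Longrightarrow>
     \<exists>t\<le>T. \<exists>R1 A1 R1' M1'.
        (step w (pre @ compile c (length pre) @ post) ^^ t) (length pre, R', M') =
          (length pre + length (compile c (length pre)), R1', M1') \<and>
        represents xs R1 A1 R1' M1' \<and> Q R1 A1"
  shows "runs w xs c R A T Q"
  using assms unfolding runs_def by blast

lemma runsD: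
  assumes "runs w xs c R A T Q" "represents xs R A R' M'"
    "prog = pre @ compile c pc @ post" "pc = length pre"
  shows "\<exists>t R1 A1 R1' M1'. t \<le> T \<and>
    (step w prog ^^ t) (pc, R', M') = (pc + length (compile c pc), R1', M1') \<and>
    represents xs R1 A1 R1' M1' \<and> Q R1 A1"
  using assms unfolding runs_def by blast

fun is_jump :: "instr \<Rightarrow> bool" where
  "is_jump (Jump j) = True" | "is_jump (JumpZero r j) = True" | "is_jump _ = False"

lemma step_nth:
  assumes "prog = pre @ i # post" "pc = length pre"
  shows "step w prog (pc, R, M) = exec_instr w i (pc, R, M)"
  using assms by (simp add: step_def halted_def)

lemma fst_exec_instr:
  "\<not> is_jump i \<Longrightarrow> fst (exec_instr w i cfg) = Suc (fst cfg)"
  by (cases cfg; cases i) auto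

text \<open>Every instruction other than a jump increments the program counter, so the machine
  simply walks through the list.\<close>

lemma straight_line_steps:
  assumes "\<forall>i\<in>set is. \<not> is_jump i" "prog = pre @ is @ post" "pc = length pre"
  shows "(step w prog ^^ length is) (pc, R, M) = fold (exec_instr w) is (pc, R, M)"
  using assms
proof (induction "is" arbitrary: pre pc R M)
  case (Cons i js)
  obtain pc' R' M' where e: "exec_instr w i (pc, R, M) = (pc', R', M')"
    by (metis prod_cases3)
  have "pc' = Suc pc"
    using fst_exec_instr[of i w "(pc, R, M)"] Cons.prems e by auto
  moreover have "step w prog (pc, R, M) = exec_instr w i (pc, R, M)"
    using Cons.prems by (intro step_nth) auto
  moreover have "(step w prog ^^ length js) (pc', R', M') = fold (exec_instr w) js (pc', R', M')"
    using Cons.prems \<open>pc' = Suc pc\<close> by (intro Cons.IH[of "pre @ [i]"]) auto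
  ultimately show ?case
    by (simp add: funpow_Suc_right e del: funpow.simps)
qed auto

lemma runs_straight_line:
  assumes "\<And>pc. compile c pc = code" "\<forall>i\<in>set code. \<not> is_jump i" "Q R1 A1"
    and "\<And>pc R' M'. represents xs R A R' M' \<Longrightarrow>
      \<exists>R1' M1'. fold (exec_instr w) code (pc, R', M') = (pc + length code, R1', M1') \<and>
        represents xs R1 A1 R1' M1'"
    and "T = length code"
  shows "runs w xs c R A T Q"
proof (rule runsI)
  fix pre post :: program and R' M'
  assume r: "represents xs R A R' M'"
  have "(step w (pre @ code @ post) ^^ length code) (length pre, R', M')
    = fold (exec_instr w) code (length pre, R', M')"
    by (rule straight_line_steps[OF assms(2) refl refl])
  with assms(3,5) assms(4)[OF r, of "length pre"]
  show "\<exists>t\<le>T. \<exists>R1 A1 R1' M1'.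
        (step w (pre @ compile c (length pre) @ post) ^^ t) (length pre, R', M') =
          (length pre + length (compile c (length pre)), R1', M1') \<and>
        represents xs R1 A1 R1' M1' \<and> Q R1 A1"
    unfolding assms(1) by (metis order_refl)
qed

lemma runs_mono:
  assumes "runs w xs c R A T P" "T \<le> T'" "\<And>R A. P R A \<Longrightarrow> Q R A"
  shows "runs w xs c R A T' Q"
  using assms unfolding runs_def by (meson le_trans)

lemma runs_Seq:
  assumes "runs w xs c R A T P" "\<And>R A. P R A \<Longrightarrow> runs w xs d R A T' Q"
  shows "runs w xs (c ;; d) R A (T + T') Q"
proof (rule runsI)
  fix pre post :: program and R' M'
  assume r: "represents xs R A R' M'"
  define cs where "cs = compile c (length pre)"
  define ds where "ds = compile d (length pre + length cs)"
  define prog where "prog = pre @ (cs @ ds) @ post"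
  have prog1: "prog = pre @ compile c (length pre) @ ds @ post"
    by (simp add: prog_def cs_def)
  have prog2: "prog = (pre @ cs) @ compile d (length pre + length cs) @ post"
    by (simp add: prog_def ds_def)
  obtain t R1 A1 R1' M1' where 1: "t \<le> T"
    "(step w prog ^^ t) (length pre, R', M') = (length pre + length cs, R1', M1')"
    "represents xs R1 A1 R1' M1'" "P R1 A1"
    using runsD[OF assms(1) r prog1 refl] unfolding cs_def by blast
  obtain t' R2 A2 R2' M2' where 2: "t' \<le> T'"
    "(step w prog ^^ t') (length pre + length cs, R1', M1')
       = (length pre + length cs + length ds, R2', M2')"
    "represents xs R2 A2 R2' M2'" "Q R2 A2"
    using runsD[OF assms(2)[OF 1(4)] 1(3) prog2] unfolding ds_def by auto
  have "(step w prog ^^ (t' + t)) (length pre, R', M')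
      = (length pre + length (cs @ ds), R2', M2')"
    using 1(2) 2(2) by (simp add: funpow_add)
  moreover have "compile (c ;; d) (length pre) = cs @ ds"
    by (simp add: cs_def ds_def Let_def)
  ultimately show "\<exists>t\<le>T + T'. \<exists>R1 A1 R1' M1'.
        (step w (pre @ compile (c ;; d) (length pre) @ post) ^^ t) (length pre, R', M') =
          (length pre + length (compile (c ;; d) (length pre)), R1', M1') \<and>
        represents xs R1 A1 R1' M1' \<and> Q R1 A1"
    using 1(1) 2(1,3,4) unfolding prog_def by (intro exI[of _ "t' + t"]) auto
qed

lemma represents_reg: "represents xs R A R' M' \<Longrightarrow> R' (reg_no x) = R x"
  by (simp add: represents_def)

text \<open>The two extra steps are the test and the jump over the other branch. Adding both branch
  bounds instead of taking their maximum keeps \<open>cost\<close> a plain sum.\<close>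

lemma runs_IfNZ:
  assumes "R x \<noteq> 0 \<Longrightarrow> runs w xs c R A T Q" "R x = 0 \<Longrightarrow> runs w xs d R A T' Q"
  shows "runs w xs (IfNZ x c d) R A (2 + (T + T')) Q"
proof (rule runsI)
  fix pre post :: program and R' M'
  assume r: "represents xs R A R' M'"
  define cs where "cs = compile c (Suc (length pre))"
  define pc' where "pc' = length pre + length cs + 2"
  define ds where "ds = compile d pc'"
  define code where "code = JumpZero (reg_no x) pc' # cs @ Jump (pc' + length ds) # ds"
  define prog where "prog = pre @ code @ post"
  have code: "compile (IfNZ x c d) (length pre) = code"
    by (simp add: code_def cs_def ds_def pc'_def Let_def)
  have len: "length pre + length code = pc' + length ds"
    by (simp add: code_def pc'_def)
  have s1: "step w prog (length pre, R', M') = (if R x = 0 then pc' else Suc (length pre), R', M')"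
    using step_nth[of prog pre "JumpZero (reg_no x) pc'"] represents_reg[OF r, of x]
    by (simp add: prog_def code_def)
  have "\<exists>t\<le>2 + (T + T'). \<exists>R1 A1 R1' M1'.
        (step w prog ^^ t) (length pre, R', M') = (length pre + length code, R1', M1') \<and>
        represents xs R1 A1 R1' M1' \<and> Q R1 A1"
  proof (cases "R x = 0")
    case True
    have prog: "prog = (pre @ JumpZero (reg_no x) pc' # cs @ [Jump (pc' + length ds)])
        @ compile d pc' @ post"
      by (simp add: prog_def code_def flip: ds_def)
    have pc': "pc' = length (pre @ JumpZero (reg_no x) pc' # cs @ [Jump (pc' + length ds)])"
      by (simp add: pc'_def)
    obtain t R1 A1 R1' M1' where 1: "t \<le> T'"
      "(step w prog ^^ t) (pc', R', M') = (pc' + length ds, R1', M1')"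
      "represents xs R1 A1 R1' M1'" "Q R1 A1"
      using runsD[OF assms(2)[OF True] r prog pc'] unfolding ds_def by blast
    have "(step w prog ^^ Suc t) (length pre, R', M') = (length pre + length code, R1', M1')"
      using s1 True 1(2) len by (simp add: funpow_Suc_right del: funpow.simps)
    then show ?thesis using 1 by (intro exI[of _ "Suc t"]) auto
  next
    case False
    have prog: "prog = (pre @ [JumpZero (reg_no x) pc']) @ compile c (Suc (length pre))
        @ Jump (pc' + length ds) # ds @ post"
      by (simp add: prog_def code_def flip: cs_def)
    obtain t R1 A1 R1' M1' where 1: "t \<le> T"
      "(step w prog ^^ t) (Suc (length pre), R', M') = (Suc (length pre) + length cs, R1', M1')"
      "represents xs R1 A1 R1' M1'" "Q R1 A1"
      using runsD[OF assms(1)[OF False] r prog] unfolding cs_def by auto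
    have "step w prog (Suc (length pre) + length cs, R1', M1') = (pc' + length ds, R1', M1')"
      using step_nth[of prog "pre @ JumpZero (reg_no x) pc' # cs" "Jump (pc' + length ds)"]
      by (simp add: prog_def code_def)
    then have "(step w prog ^^ Suc (Suc t)) (length pre, R', M')
        = (length pre + length code, R1', M1')"
      using s1 False 1(2) len
      by (subst funpow_Suc_right) simp
    then show ?thesis using 1 by (intro exI[of _ "Suc (Suc t)"]) auto
  qed
  then show "\<exists>t\<le>2 + (T + T'). \<exists>R1 A1 R1' M1'.
        (step w (pre @ compile (IfNZ x c d) (length pre) @ post) ^^ t) (length pre, R', M') =
          (length pre + length (compile (IfNZ x c d) (length pre)), R1', M1') \<and>
        represents xs R1 A1 R1' M1' \<and> Q R1 A1"
    unfolding code prog_def by blast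
qed

text \<open>The last argument of the invariant is a variant, which may drop by more than one per
  round. A round costs the body plus the test and the jump back; the final \<open>+ 1\<close> is the
  failing test.\<close>

lemma runs_While:
  assumes body: "\<And>R A n. I R A n \<Longrightarrow> R x \<noteq> 0 \<Longrightarrow>
      runs w xs c R A K (\<lambda>R' A'. \<exists>n'<n. I R' A' n')"
    and init: "I R A n"
  shows "runs w xs (While x c) R A ((K + 2) * n + 1) (\<lambda>R' A'. R' x = 0 \<and> (\<exists>n'. I R' A' n'))"
proof (rule runsI)
  fix pre post :: program and R' M'
  assume r: "represents xs R A R' M'"
  define cs where "cs = compile c (Suc (length pre))"
  define pc' where "pc' = length pre + length cs + 2"
  define code where "code = JumpZero (reg_no x) pc' # cs @ [Jump (length pre)]"
  define prog where "prog = pre @ code @ post"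
  have code: "compile (While x c) (length pre) = code"
    by (simp add: code_def cs_def pc'_def Let_def)
  have len: "length pre + length code = pc'"
    by (simp add: code_def pc'_def)
  have "\<exists>t\<le>(K + 2) * n + 1. \<exists>R1 A1 R1' M1'.
        (step w prog ^^ t) (length pre, R', M') = (pc', R1', M1') \<and>
        represents xs R1 A1 R1' M1' \<and> R1 x = 0 \<and> (\<exists>n'. I R1 A1 n')"
    using r init
  proof (induction n arbitrary: R A R' M' rule: less_induct)
    case (less n)
    note r = less.prems(1) and I = less.prems(2)
    have s1: "step w prog (length pre, R', M') = (if R x = 0 then pc' else Suc (length pre), R', M')"
      using step_nth[of prog pre "JumpZero (reg_no x) pc'"] represents_reg[OF r, of x]
      by (simp add: prog_def code_def)
    show ?case
    proof (cases "R x = 0")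
      case True
      then show ?thesis using s1 r I
        by (intro exI[of _ 1]) auto
    next
      case False
      have prog: "prog = (pre @ [JumpZero (reg_no x) pc']) @ compile c (Suc (length pre))
          @ Jump (length pre) # post"
        by (simp add: prog_def code_def flip: cs_def)
      obtain t R1 A1 R1' M1' where 1: "t \<le> K"
        "(step w prog ^^ t) (Suc (length pre), R', M') = (Suc (length pre) + length cs, R1', M1')"
        "represents xs R1 A1 R1' M1'" "\<exists>n'<n. I R1 A1 n'"
        using runsD[OF body[OF I False] r prog] unfolding cs_def by fastforce
      then obtain n' where n': "n' < n" "I R1 A1 n'" by blast
      have s2: "step w prog (Suc (length pre) + length cs, R1', M1') = (length pre, R1', M1')"
        using step_nth[of prog "pre @ JumpZero (reg_no x) pc' # cs" "Jump (length pre)"]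
        by (simp add: prog_def code_def)
      have s3: "(step w prog ^^ Suc (Suc t)) (length pre, R', M') = (length pre, R1', M1')"
        using s1 False 1(2) s2 by (subst funpow_Suc_right) simp
      obtain t' R2 A2 R2' M2' where 2: "t' \<le> (K + 2) * n' + 1"
        "(step w prog ^^ t') (length pre, R1', M1') = (pc', R2', M2')"
        "represents xs R2 A2 R2' M2'" "R2 x = 0" "\<exists>n'. I R2 A2 n'"
        using less.IH[OF n'(1) 1(3) n'(2)] by blast
      have "(step w prog ^^ (t' + Suc (Suc t))) (length pre, R', M') = (pc', R2', M2')"
        using s3 2(2) by (simp only: funpow_add o_apply)
      moreover have "t' + Suc (Suc t) \<le> (K + 2) * n + 1"
      proof -
        have "(K + 2) * Suc n' \<le> (K + 2) * n" using n'(1) by (intro mult_le_mono) auto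
        then show ?thesis using 1(1) 2(1) by simp
      qed
      ultimately show ?thesis using 2(3-5) by blast
    qed
  qed
  then show "\<exists>t\<le>(K + 2) * n + 1. \<exists>R1 A1 R1' M1'.
        (step w (pre @ compile (While x c) (length pre) @ post) ^^ t) (length pre, R', M') =
          (length pre + length (compile (While x c) (length pre)), R1', M1') \<and>
        represents xs R1 A1 R1' M1' \<and> R1 x = 0 \<and> (\<exists>n'. I R1 A1 n')"
    unfolding code prog_def len .
qed

text \<open>
  The sums and indices that a program computes have to stay below \<open>B\<close>, which excludes overflow.
  Only loop-free programs have a weakest precondition other than \<open>False\<close>.
\<close>

fun wp :: "nat \<Rightarrow> nat list \<Rightarrow> com \<Rightarrow> (regs \<Rightarrow> arrs \<Rightarrow> bool) \<Rightarrow> regs \<Rightarrow> arrs \<Rightarrow> bool" where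
  "wp B xs Skip Q R A = Q R A"
| "wp B xs (Const x k) Q R A = (k < B \<and> Q (R(x := k)) A)"
| "wp B xs (Plus x y z) Q R A = (R y + R z < B \<and> Q (R(x := R y + R z)) A)"
| "wp B xs (Minus x y z) Q R A = Q (R(x := R y - R z)) A"
| "wp B xs (Input x y) Q R A = (R y < length xs \<and> Q (R(x := xs ! R y)) A)"
| "wp B xs (Read x a y) Q R A = (R y < B \<and> Q (R(x := A a (R y))) A)"
| "wp B xs (Write a y x) Q R A = (R y < B \<and> Q R (A(a := (A a)(R y := R x))))"
| "wp B xs (c ;; d) Q R A = wp B xs c (wp B xs d Q) R A"
| "wp B xs (IfNZ x c d) Q R A = (if R x \<noteq> 0 then wp B xs c Q R A else wp B xs d Q R A)"
| "wp B xs (While x c) Q R A = False"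

text \<open>The 8 consists of seven instructions for the address and one memory access.\<close>

fun cost :: "com \<Rightarrow> nat" where
  "cost Skip = 0"
| "cost (Read x a y) = 8"
| "cost (Write a y x) = 8"
| "cost (c ;; d) = cost c + cost d"
| "cost (IfNZ x c d) = 2 + (cost c + cost d)"
| "cost _ = 1"

lemma length_address_code [simp]: "length (address_code a y) = 7"
  by (simp add: address_code_def)

lemma address_code_no_jump: "i \<in> set (address_code a y) \<Longrightarrow> \<not> is_jump i"
  by (auto simp: address_code_def)

text \<open>The bound on \<open>B\<close> keeps the largest address of any cell with index below
  \<open>B\<close> under \<open>2 ^ w\<close>, so no intermediate sum wraps around.\<close>

lemma address_code_exec:
  assumes "represents xs R A R' M" "16 * B + 16 + length xs \<le> 2 ^ w" "R y < B"
  shows "\<exists>r1. fold (exec_instr w) (address_code a y) (pc, R', M) =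
     (pc + 7, R'(1 := r1, 0 := length xs + 16 * R y + arr_no a), M)"
proof -
  have "arr_no a < 2 ^ w" "8 * R y < 2 ^ w" "16 * R y + arr_no a + length xs < 2 ^ w"
    using assms(2,3) arr_no_less[of a] by linarith+
  with assms(1) show ?thesis
    by (simp add: address_code_def represents_def fun_eq_iff algebra_simps)
qed

lemma represents_scratch [simp]:
  "represents xs R A (R'(0 := r)) M = represents xs R A R' M"
  "represents xs R A (R'(Suc 0 := r)) M = represents xs R A R' M"
  by (simp_all add: represents_def)

lemma represents_set:
  "represents xs R A R' M \<Longrightarrow> represents xs (R(x := v)) A (R'(reg_no x := v)) M"
  by (simp add: represents_def)

text \<open>Uniqueness of quotient and remainder modulo 16.\<close>

lemma interleaved_eq_iff:
  "length xs + 16 * i + arr_no a = length xs + 16 * j + arr_no b \<longleftrightarrow> i = j \<and> a = b"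
proof
  assume h: "length xs + 16 * i + arr_no a = length xs + 16 * j + arr_no b"
  then have "i = j" using arr_no_less[of a] arr_no_less[of b] by linarith
  with h show "i = j \<and> a = b" by simp
qed simp

lemma represents_write:
  assumes "represents xs R A R' M"
  shows "represents xs R (A(a := (A a)(i := v))) R' (M(length xs + 16 * i + arr_no a := v))"
  using assms unfolding represents_def
  by (simp add: interleaved_eq_iff)

text \<open>Soundness of \<open>wp\<close>: loop-free code is verified by symbolic execution in the
  simplifier, with \<open>cost\<close> as its running time. Loops are treated separately by
  \<open>runs_While\<close> and \<open>runs_count_down\<close>.\<close>

lemma wp_runs:
  assumes B: "16 * B + 16 + length xs \<le> 2 ^ w"
  shows "wp B xs c Q R A \<Longrightarrow> runs w xs c R A (cost c) Q"
proof (induction c arbitrary: Q R A)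
  case Skip
  then show ?case by (intro runs_straight_line[where Q = Q and code = "[]" and ?R1.0 = R and ?A1.0 = A]) auto
next
  case (Const x k)
  then have "k < 2 ^ w" and Q: "Q (R(x := k)) A" using B by simp_all
  then show ?case
    by (intro runs_straight_line[where Q = Q and code = "[LoadConst (reg_no x) k]", OF _ _ Q])
      (simp_all add: represents_set)
next
  case (Plus x y z)
  then have "R y + R z < 2 ^ w" and Q: "Q (R(x := R y + R z)) A" using B by simp_all
  then show ?case
    by (intro runs_straight_line[where Q = Q and code = "[Add (reg_no x) (reg_no y) (reg_no z)]", OF _ _ Q])
      (simp_all add: represents_set represents_reg)
next
  case (Minus x y z)
  then have Q: "Q (R(x := R y - R z)) A" by simp
  show ?case
    by (intro runs_straight_line[where Q = Q and code = "[Sub (reg_no x) (reg_no y) (reg_no z)]", OF _ _ Q])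
      (simp_all add: represents_set represents_reg)
next
  case (Input x y)
  then have y: "R y < length xs" and Q: "Q (R(x := xs ! R y)) A" by simp_all
  have "M (R' (reg_no y)) = xs ! R y" if "represents xs R A R' M" for R' M
    using that y by (simp add: represents_def)
  then show ?case
    by (intro runs_straight_line[where Q = Q and code = "[Load (reg_no x) (reg_no y)]", OF _ _ Q])
      (simp_all add: represents_set)
next
  case (Read x a y)
  then have y: "R y < B" and Q: "Q (R(x := A a (R y))) A" by simp_all
  show ?case
  proof (rule runs_straight_line[where Q = Q and code = "address_code a y @ [Load (reg_no x) 0]", OF _ _ Q])
    fix pc R' M'
    assume r: "represents xs R A R' M'"
    obtain r1 where "fold (exec_instr w) (address_code a y) (pc, R', M') =
       (pc + 7, R'(1 := r1, 0 := length xs + 16 * R y + arr_no a), M')"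
      using address_code_exec[OF r B y] by blast
    moreover have "M' (length xs + 16 * R y + arr_no a) = A a (R y)"
      using r by (simp add: represents_def)
    moreover have "represents xs (R(x := A a (R y))) A
        (R'(1 := r1, 0 := length xs + 16 * R y + arr_no a, reg_no x := A a (R y))) M'"
      using r by (intro represents_set) simp
    ultimately show "\<exists>R1' M1'. fold (exec_instr w) (address_code a y @ [Load (reg_no x) 0]) (pc, R', M')
        = (pc + length (address_code a y @ [Load (reg_no x) 0]), R1', M1') \<and>
        represents xs (R(x := A a (R y))) A R1' M1'"
      by simp
  qed (auto simp: address_code_no_jump)
next
  case (Write a y x)
  then have y: "R y < B" and Q: "Q R (A(a := (A a)(R y := R x)))" by simp_all
  show ?case
  proof (rule runs_straight_line[where Q = Q and code = "address_code a y @ [Store 0 (reg_no x)]", OF _ _ Q])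
    fix pc R' M'
    assume r: "represents xs R A R' M'"
    obtain r1 where "fold (exec_instr w) (address_code a y) (pc, R', M') =
       (pc + 7, R'(1 := r1, 0 := length xs + 16 * R y + arr_no a), M')"
      using address_code_exec[OF r B y] by blast
    moreover have "represents xs R (A(a := (A a)(R y := R x)))
        (R'(1 := r1, 0 := length xs + 16 * R y + arr_no a))
        (M'(length xs + 16 * R y + arr_no a := R x))"
      using r by (intro represents_write) simp
    ultimately show "\<exists>R1' M1'. fold (exec_instr w) (address_code a y @ [Store 0 (reg_no x)]) (pc, R', M')
        = (pc + length (address_code a y @ [Store 0 (reg_no x)]), R1', M1') \<and>
        represents xs R (A(a := (A a)(R y := R x))) R1' M1'"
      using represents_reg[OF r] by simp
  qed (auto simp: address_code_no_jump)
next
  case (Seq c d)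
  then show ?case by (auto intro!: runs_Seq)
next
  case (IfNZ x c d)
  then show ?case by (auto intro!: runs_IfNZ[simplified])
qed auto

lemma wp_mono: "wp B xs c P R A \<Longrightarrow> (\<And>R A. P R A \<Longrightarrow> Q R A) \<Longrightarrow> wp B xs c Q R A"
proof (induction c arbitrary: P Q R A)
  case (Seq c d)
  from Seq.prems(1) have "wp B xs c (wp B xs d P) R A" by simp
  then have "wp B xs c (wp B xs d Q) R A"
    by (rule Seq.IH(1)) (rule Seq.IH(2)[OF _ Seq.prems(2)])
  then show ?case by simp
qed (auto split: if_splits)

text \<open>Here the variant is the content of the loop register itself, so the number of rounds is
  known exactly and the invariant at exit has index 0.\<close>

lemma runs_count_down:
  assumes body: "\<And>R A k. I R A (Suc k) \<Longrightarrow> runs w xs c R A K (\<lambda>R' A'. I R' A' k)"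
    and cnt: "\<And>R A k. I R A k \<Longrightarrow> R x = k"
    and init: "I R A n"
  shows "runs w xs (While x c) R A ((K + 2) * n + 1) (\<lambda>R' A'. I R' A' 0)"
proof (rule runs_mono[OF runs_While[where I = I and K = K and n = n], OF _ init])
  fix R A k assume "I R A k" "R x \<noteq> 0"
  then obtain k' where k': "k = Suc k'" "I R A (Suc k')" using cnt by (metis not0_implies_Suc)
  show "runs w xs c R A K (\<lambda>R' A'. \<exists>n'<k. I R' A' n')"
    by (rule runs_mono[OF body[OF k'(2)]]) (auto simp: k'(1))
next
  show "I R' A' 0" if "R' x = 0 \<and> (\<exists>n'. I R' A' n')" for R' A'
    using that cnt by force
qed simp

lemma runs_init_count_down:
  assumes "runs w xs c0 R A T0 (\<lambda>R' A'. I R' A' n)"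
    and "\<And>R A k. I R A (Suc k) \<Longrightarrow> runs w xs c R A K (\<lambda>R' A'. I R' A' k)"
    and "\<And>R A k. I R A k \<Longrightarrow> R x = k"
    and "T0 + ((K + 2) * n + 1) \<le> T"
  shows "runs w xs (c0 ;; While x c) R A T (\<lambda>R' A'. I R' A' 0)"
  by (rule runs_mono[OF runs_Seq[OF assms(1) runs_count_down[where I = I]]]) (use assms in auto)

section \<open>The Knuth-Morris-Pratt automaton\<close>

text \<open>This is the state of the Knuth-Morris-Pratt automaton after reading
  \<open>u\<close>.\<close>

definition overlap :: "'a list \<Rightarrow> 'a list \<Rightarrow> nat" where
  "overlap S u = Max {j. j \<le> length S \<and> suffix (take j S) u}"

definition delta :: "'a list \<Rightarrow> nat \<Rightarrow> 'a \<Rightarrow> nat" where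
  "delta S q a = overlap S (take q S @ [a])"

lemma overlap_in: "overlap S u \<in> {j. j \<le> length S \<and> suffix (take j S) u}"
proof -
  have "finite {j. j \<le> length S \<and> suffix (take j S) u}"
    by (rule finite_subset[of _ "{..length S}"]) auto
  moreover have "0 \<in> {j. j \<le> length S \<and> suffix (take j S) u}" by simp
  ultimately show ?thesis unfolding overlap_def by (intro Max_in) blast+
qed

lemma overlap_le: "overlap S u \<le> length S"
  and suffix_overlap: "suffix (take (overlap S u) S) u"
  using overlap_in[of S u] by auto

lemma overlap_ge: "j \<le> length S \<Longrightarrow> suffix (take j S) u \<Longrightarrow> j \<le> overlap S u"
  unfolding overlap_def
  by (rule Max_ge) (auto intro: finite_subset[of _ "{..length S}"])

lemma overlap_le_length: "overlap S u \<le> length u"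
  using suffix_length_le[OF suffix_overlap[of S u]] overlap_le[of S u] by simp

lemma overlap_Nil [simp]: "overlap S [] = 0"
  using overlap_le_length[of S "[]"] by simp

lemma overlap_cong:
  assumes "\<And>j. j \<le> length S \<Longrightarrow> suffix (take j S) u \<longleftrightarrow> suffix (take j S) v"
  shows "overlap S u = overlap S v"
  unfolding overlap_def using assms by metis

lemma overlap_eq_length_iff: "overlap S u = length S \<longleftrightarrow> suffix S u"
  using suffix_overlap[of S u] overlap_ge[of "length S" S u] overlap_le[of S u] by auto

text \<open>A nonempty prefix of \<open>S\<close> that ends \<open>u @ [a]\<close> is a shorter
  prefix ending \<open>u\<close>, followed by \<open>a\<close>. That shorter prefix is no longer
  than the longest one ending \<open>u\<close>, and of two suffixes of one word the shorter is a
  suffix of the longer. Hence the state alone determines the next state.\<close>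

lemma overlap_snoc: "overlap S (u @ [a]) = delta S (overlap S u) a"
  unfolding delta_def
proof (rule overlap_cong)
  fix j assume j: "j \<le> length S"
  let ?t = "take (overlap S u) S"
  show "suffix (take j S) (u @ [a]) \<longleftrightarrow> suffix (take j S) (?t @ [a])"
  proof
    assume "suffix (take j S) (?t @ [a])"
    moreover have "suffix (?t @ [a]) (u @ [a])" using suffix_overlap[of S u] by simp
    ultimately show "suffix (take j S) (u @ [a])" by (rule suffix_order.trans)
  next
    assume h: "suffix (take j S) (u @ [a])"
    show "suffix (take j S) (?t @ [a])"
    proof (cases j)
      case 0
      then show ?thesis by simp
    next
      case (Suc i)
      have t: "take j S = take i S @ [S ! i]"
        using Suc j by (simp add: take_Suc_conv_app_nth)
      with h have a: "S ! i = a" and s: "suffix (take i S) u" by auto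
      have "i \<le> overlap S u" using s Suc j by (intro overlap_ge) auto
      then have "suffix (take i S) ?t"
        using suffix_length_suffix[OF s suffix_overlap] Suc j overlap_le[of S u] by simp
      with t a show ?thesis by simp
    qed
  qed
qed

lemma foldl_delta: "foldl (delta S) (overlap S u) v = overlap S (u @ v)"
proof (induction v arbitrary: u)
  case (Cons a v)
  then show ?case using Cons[of "u @ [a]"] by (simp add: overlap_snoc)
qed simp

lemma delta_match: "q < length S \<Longrightarrow> delta S q (S ! q) = Suc q"
proof -
  assume q: "q < length S"
  then have t: "take q S @ [S ! q] = take (Suc q) S" by (simp add: take_Suc_conv_app_nth)
  have "Suc q \<le> overlap S (take (Suc q) S)" using q by (intro overlap_ge) auto
  moreover have "overlap S (take (Suc q) S) \<le> Suc q"
    using overlap_le_length[of S "take (Suc q) S"] q by simp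
  ultimately show ?thesis by (simp add: delta_def t)
qed

text \<open>On a mismatch the whole word \<open>take q S @ [a]\<close> is not a prefix of
  \<open>S\<close>, so only its proper suffixes compete. For positive \<open>q\<close> this is a
  transition from the failure state of \<open>q\<close>; for \<open>q = 0\<close> the tail is empty
  and the result is 0.\<close>

lemma delta_mismatch:
  assumes "q < length S" "S ! q \<noteq> a"
  shows "delta S q a = overlap S (tl (take q S @ [a]))"
  unfolding delta_def
proof (rule overlap_cong)
  fix j assume j: "j \<le> length S"
  have "take (Suc q) S \<noteq> take q S @ [a]"
    using assms by (simp add: take_Suc_conv_app_nth)
  moreover have "j = Suc q" if "take j S = take q S @ [a]"
    using arg_cong[OF that, of length] j assms(1) by simp
  ultimately have "take j S \<noteq> take q S @ [a]" by blast
  then show "suffix (take j S) (take q S @ [a]) \<longleftrightarrow> suffix (take j S) (tl (take q S @ [a]))"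
    by (cases "take q S @ [a]") (auto simp: suffix_Cons)
qed

lemma delta_le: "delta S q a \<le> length S"
  by (simp add: delta_def overlap_le)

section \<open>Paths in directed acyclic graphs\<close>

lemma dagD:
  assumes "dag V E"
  shows "finite V" "finite E" "E \<subseteq> V \<times> V" "acyclic E" "wf E"
proof -
  show "finite V" "E \<subseteq> V \<times> V" "acyclic E" using assms by (auto simp: dag_def)
  then show "finite E" by (meson finite_SigmaI finite_subset)
  with \<open>acyclic E\<close> show "wf E" by (simp add: finite_acyclic_wf)
qed

lemma dag_converse: "dag V E \<Longrightarrow> dag V (E\<inverse>)"
  by (auto simp: dag_def acyclic_converse)

lemma is_path_Cons_iff':
  "is_path V E (v # p) \<longleftrightarrow>
     v \<in> V \<and> v \<notin> set p \<and> (p = [] \<or> (v, hd p) \<in> E \<and> is_path V E p)"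
proof -
  have "(\<forall>i. Suc i < length (v # p) \<longrightarrow> ((v # p) ! i, (v # p) ! Suc i) \<in> E) \<longleftrightarrow>
    (p = [] \<or> (v, hd p) \<in> E \<and> (\<forall>i. Suc i < length p \<longrightarrow> (p ! i, p ! Suc i) \<in> E))"
    by (cases p) (auto simp: nth_Cons split: nat.splits)
  then show ?thesis by (auto simp: is_path_def)
qed

lemma path_reaches:
  "is_path V E p \<Longrightarrow> x \<in> set p \<Longrightarrow> (hd p, x) \<in> E\<^sup>*"
proof (induction p)
  case (Cons v p)
  then show ?case
    by (auto simp: is_path_Cons_iff' intro: converse_rtrancl_into_rtrancl)
qed simp

text \<open>Acyclicity gives distinctness: if \<open>v\<close> occurred in \<open>p\<close>, the
  edge into \<open>hd p\<close> would close a cycle.\<close>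

lemma is_path_Cons_iff:
  assumes "dag V E"
  shows "is_path V E (v # p) \<longleftrightarrow> v \<in> V \<and> (p = [] \<or> (v, hd p) \<in> E \<and> is_path V E p)"
proof -
  have "v \<notin> set p" if "(v, hd p) \<in> E" "is_path V E p"
  proof
    assume "v \<in> set p"
    then have "(hd p, v) \<in> E\<^sup>*" using path_reaches[OF that(2)] by blast
    with that(1) have "(v, v) \<in> E\<^sup>+" by (rule rtrancl_into_trancl2)
    then show False using dagD(4)[OF assms] by (simp add: acyclic_def)
  qed
  then show ?thesis by (auto simp: is_path_Cons_iff')
qed

lemma is_path_singleton [simp]: "is_path V E [v] \<longleftrightarrow> v \<in> V"
  by (simp add: is_path_def)

lemma is_path_hd_in: "is_path V E p \<Longrightarrow> hd p \<in> V"
  by (cases p) (auto simp: is_path_def)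

lemma is_path_last_in: "is_path V E p \<Longrightarrow> last p \<in> V"
  by (auto simp: is_path_def)

lemma is_path_neq_Nil: "is_path V E p \<Longrightarrow> p \<noteq> []"
  by (simp add: is_path_def)

lemma finite_paths: "finite V \<Longrightarrow> finite {p. is_path V E p \<and> P p}"
  by (rule finite_subset[OF _ finite_subset_distinct[of V]]) (auto simp: is_path_def)

lemma is_path_suffix:
  assumes "is_path V E (p @ p')" "p' \<noteq> []"
  shows "is_path V E p'"
  using assms by (induction p) (auto simp: is_path_Cons_iff')

lemma is_source_iff: "dag V E \<Longrightarrow> is_source V E v \<longleftrightarrow> v \<in> V \<and> (\<forall>u. (u, v) \<notin> E)"
proof -
  assume "dag V E"
  note D = dagD[OF this]
  have "finite {u. (u, v) \<in> E}"
    by (rule finite_subset[OF _ D(1)]) (use D(3) in auto)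
  then show ?thesis by (auto simp: is_source_def in_degree_def)
qed

text \<open>Predecessors are prepended as long as there are any; this ends because a finite acyclic
  relation is well founded.\<close>

lemma path_extends_to_source:
  assumes "dag V E"
  shows "is_path V E p \<Longrightarrow> \<exists>p'. is_path V E (p' @ p) \<and> is_source V E (hd (p' @ p))"
proof (induction "hd p" arbitrary: p rule: wf_induct_rule[OF dagD(5)[OF assms]])
  case (1 p)
  show ?case
  proof (cases "is_source V E (hd p)")
    case True
    then show ?thesis using 1 by (intro exI[of _ "[]"]) auto
  next
    case False
    then obtain u where u: "(u, hd p) \<in> E"
      using is_source_iff[OF assms] is_path_hd_in[OF 1(2)] by blast
    then have "is_path V E (u # p)"
      using 1(2) dagD(3)[OF assms] by (auto simp: is_path_Cons_iff[OF assms])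
    with 1(1)[of "u # p"] u obtain p' where
      "is_path V E (p' @ u # p)" "is_source V E (hd (p' @ u # p))" by auto
    then show ?thesis by (intro exI[of _ "p' @ [u]"]) auto
  qed
qed

lemma source_exists:
  assumes "dag V E" "V \<noteq> {}"
  shows "\<exists>s. is_source V E s"
proof -
  obtain v where "is_path V E [v]" using assms(2) by auto
  then show ?thesis using path_extends_to_source[OF assms(1)] by blast
qed

section \<open>Counting paths\<close>

definition num_paths_from :: "'v set \<Rightarrow> ('v \<times> 'v) set \<Rightarrow> 'v \<Rightarrow> nat" where
  "num_paths_from V E v = card {p. is_path V E p \<and> hd p = v}"

text \<open>A path from \<open>v\<close> is \<open>[v]\<close> or continues with a path from a
  successor; the second vertex separates the cases. This matches one expansion step of the
  search.\<close>

lemma num_paths_from_rec: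
  assumes "dag V E" "v \<in> V"
  shows "num_paths_from V E v = Suc (\<Sum>u\<in>E `` {v}. num_paths_from V E u)"
proof -
  have fin: "finite {p. is_path V E p \<and> hd p = u}" for u
    using dagD(1)[OF assms(1)] by (rule finite_paths)
  have finE: "finite (E `` {v})"
    using dagD(2)[OF assms(1)] by (rule finite_Image)
  let ?X = "\<Union>u\<in>E `` {v}. (#) v ` {p. is_path V E p \<and> hd p = u}"
  have "{p. is_path V E p \<and> hd p = v} = insert [v] ?X"
  proof (intro set_eqI iffI)
    fix p assume "p \<in> {p. is_path V E p \<and> hd p = v}"
    then obtain p' where "p = v # p'" "is_path V E (v # p')"
      by (cases p) (auto simp: is_path_def)
    then show "p \<in> insert [v] ?X"
      by (auto simp: is_path_Cons_iff[OF assms(1)])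
  next
    fix p assume "p \<in> insert [v] ?X"
    then show "p \<in> {p. is_path V E p \<and> hd p = v}"
      using assms(2) by (auto simp: is_path_Cons_iff[OF assms(1)])
  qed
  moreover have "[v] \<notin> ?X" by (auto simp: is_path_def)
  moreover have "card ?X = (\<Sum>u\<in>E `` {v}. card ((#) v ` {p. is_path V E p \<and> hd p = u}))"
    using fin finE by (intro card_UN_disjoint) auto
  moreover have "finite ?X" using fin finE by auto
  ultimately show ?thesis
    by (simp add: num_paths_from_def card_image)
qed

text \<open>Double counting of the paths that begin in a source, once by their first and once by
  their last vertex. It converts the work of the search into the quantities of the time
  bound.\<close>

lemma sum_num_paths_from_sources:
  assumes "dag V E"
  shows "(\<Sum>s | is_source V E s. num_paths_from V E s) = (\<Sum>v\<in>V. mu_s V E v)"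
proof -
  have fin: "finite {p. is_path V E p \<and> P p}" for P
    using dagD(1)[OF assms(1)] by (rule finite_paths)
  have finS: "finite {s. is_source V E s}"
    by (rule finite_subset[OF _ dagD(1)[OF assms]]) (auto simp: is_source_def)
  have "(\<Sum>s | is_source V E s. num_paths_from V E s)
      = card (\<Union>s\<in>{s. is_source V E s}. {p. is_path V E p \<and> hd p = s})"
    unfolding num_paths_from_def using fin finS by (intro card_UN_disjoint[symmetric]) auto
  also have "(\<Union>s\<in>{s. is_source V E s}. {p. is_path V E p \<and> hd p = s})
      = (\<Union>v\<in>V. {p. is_path V E p \<and> is_source V E (hd p) \<and> last p = v})"
    by (auto simp: is_path_last_in)
  also have "card \<dots> = (\<Sum>v\<in>V. mu_s V E v)"
    unfolding mu_s_def using fin dagD(1)[OF assms] by (intro card_UN_disjoint) auto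
  finally show ?thesis .
qed

lemma sum_mu_s_le:
  assumes "finite V"
  shows "(\<Sum>v\<in>V. mu_s V E v) \<le> card V * Max (mu_s V E ` V)"
  using sum_bounded_above[of V "mu_s V E" "Max (mu_s V E ` V)"] assms by simp

text \<open>The one-vertex path at a source counts. Positivity allows terms linear in the numbers of
  vertices and edges to be absorbed into the product with the maximum.\<close>

lemma Max_mu_s_pos:
  assumes "dag V E" "V \<noteq> {}"
  shows "0 < Max (mu_s V E ` V)"
proof -
  obtain s where s: "is_source V E s" using source_exists[OF assms] by blast
  then have sV: "s \<in> V" by (simp add: is_source_def)
  have "[s] \<in> {p. is_path V E p \<and> is_source V E (hd p) \<and> last p = s}" using s sV by simp
  then have "0 < mu_s V E s"
    unfolding mu_s_def card_gt_0_iff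
    using finite_paths[OF dagD(1)[OF assms(1)], of E "\<lambda>p. is_source V E (hd p) \<and> last p = s"]
    by blast
  also have "mu_s V E s \<le> Max (mu_s V E ` V)"
    using sV dagD(1)[OF assms(1)] by (intro Max_ge) auto
  finally show ?thesis .
qed

text \<open>Counting reachable vertices replaces the length of a longest path: it also drops
  strictly along edges and is at most \<open>card V\<close>.\<close>

definition height :: "('v \<times> 'v) set \<Rightarrow> 'v \<Rightarrow> nat" where
  "height E v = card (E\<^sup>* `` {v})"

lemma rtrancl_Image_subset:
  assumes "dag V E" "v \<in> V"
  shows "E\<^sup>* `` {v} \<subseteq> V"
proof
  fix x assume "x \<in> E\<^sup>* `` {v}"
  then have "(v, x) \<in> E\<^sup>*" by simp
  then show "x \<in> V" using assms(2) dagD(3)[OF assms(1)] by induction auto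
qed

lemma height_le: "dag V E \<Longrightarrow> v \<in> V \<Longrightarrow> height E v \<le> card V"
  unfolding height_def by (intro card_mono rtrancl_Image_subset dagD(1))

lemma height_pos:
  assumes "dag V E" "v \<in> V"
  shows "0 < height E v"
  unfolding height_def card_gt_0_iff
  using finite_subset[OF rtrancl_Image_subset[OF assms] dagD(1)[OF assms(1)]] by auto

text \<open>Everything reachable from \<open>v\<close> is reachable from \<open>u\<close>, while
  \<open>u\<close> itself is reachable only from \<open>u\<close>, by acyclicity.\<close>

lemma height_less:
  assumes "dag V E" "(u, v) \<in> E"
  shows "height E v < height E u"
  unfolding height_def
proof (rule psubset_card_mono)
  have "u \<in> V" using assms(2) dagD(3)[OF assms(1)] by auto
  then show "finite (E\<^sup>* `` {u})"
    by (rule finite_subset[OF rtrancl_Image_subset[OF assms(1)] dagD(1)[OF assms(1)]])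
  have "(v, u) \<notin> E\<^sup>*"
    using dagD(4)[OF assms(1)] rtrancl_into_trancl2[OF assms(2), of u] unfolding acyclic_def by blast
  then show "E\<^sup>* `` {v} \<subset> E\<^sup>* `` {u}"
    using assms(2) by (auto intro: converse_rtrancl_into_rtrancl)
qed

section \<open>Matches as accepting runs along paths\<close>

text \<open>The path may end at any vertex, so a run that passes through the accepting state counts
  as one that ends there.\<close>

definition accepts_from :: "'v set \<Rightarrow> ('v \<times> 'v) set \<Rightarrow> ('v \<Rightarrow> 'a) \<Rightarrow> 'a list \<Rightarrow> nat \<Rightarrow> 'v \<Rightarrow> bool" where
  "accepts_from V E lab S q v \<longleftrightarrow>
     (\<exists>p. is_path V E p \<and> hd p = v \<and> foldl (delta S) q (map lab p) = length S)"

lemma accepts_from_rec: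
  assumes "dag V E" "v \<in> V"
  shows "accepts_from V E lab S q v \<longleftrightarrow> delta S q (lab v) = length S \<or>
    (\<exists>u\<in>E `` {v}. accepts_from V E lab S (delta S q (lab v)) u)"
proof
  assume "accepts_from V E lab S q v"
  then obtain p where p: "is_path V E p" "hd p = v" "foldl (delta S) q (map lab p) = length S"
    by (auto simp: accepts_from_def)
  then obtain p' where p': "p = v # p'" by (cases p) (auto simp: is_path_def)
  with p show "delta S q (lab v) = length S \<or>
      (\<exists>u\<in>E `` {v}. accepts_from V E lab S (delta S q (lab v)) u)"
    by (cases "p' = []") (auto simp: is_path_Cons_iff[OF assms(1)] accepts_from_def)
next
  assume "delta S q (lab v) = length S \<or>
      (\<exists>u\<in>E `` {v}. accepts_from V E lab S (delta S q (lab v)) u)"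
  then show "accepts_from V E lab S q v"
  proof
    assume "delta S q (lab v) = length S"
    then show ?thesis using assms(2) unfolding accepts_from_def by (intro exI[of _ "[v]"]) simp
  next
    assume "\<exists>u\<in>E `` {v}. accepts_from V E lab S (delta S q (lab v)) u"
    then obtain p where "(v, hd p) \<in> E" "is_path V E p"
      "foldl (delta S) (delta S q (lab v)) (map lab p) = length S"
      by (auto simp: accepts_from_def)
    then show ?thesis using assms unfolding accepts_from_def
      by (intro exI[of _ "v # p"]) (simp add: is_path_Cons_iff)
  qed
qed

text \<open>The run accepts exactly when \<open>S\<close> is a suffix of the label read so far. A
  match becomes such a suffix after extending its path back to a source; conversely the last part of
  an accepted path is a match.\<close>

lemma has_match_iff_accepts:
  assumes "dag V E" "S \<noteq> []"
  shows "has_match V E lab S \<longleftrightarrow> (\<exists>s. is_source V E s \<and> accepts_from V E lab S 0 s)"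
proof -
  have run: "foldl (delta S) 0 u = length S \<longleftrightarrow> suffix S u" for u
    using foldl_delta[of S "[]" u] by (simp add: overlap_eq_length_iff)
  show ?thesis
  proof
    assume "has_match V E lab S"
    then obtain p where "is_path V E p" "map lab p = S"
      by (auto simp: has_match_def path_label_def)
    moreover from this obtain p' where "is_path V E (p' @ p)" "is_source V E (hd (p' @ p))"
      using path_extends_to_source[OF assms(1)] by blast
    ultimately show "\<exists>s. is_source V E s \<and> accepts_from V E lab S 0 s"
      unfolding accepts_from_def run by (intro exI[of _ "hd (p' @ p)"]) (auto simp: suffix_def)
  next
    assume "\<exists>s. is_source V E s \<and> accepts_from V E lab S 0 s"
    then obtain p where p: "is_path V E p" "suffix S (map lab p)"
      by (auto simp: accepts_from_def run)
    then obtain p1 p2 where "p = p1 @ p2" "map lab p2 = S"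
      by (metis suffixE append_eq_map_conv)
    \<comment> \<open>As \<open>S\<close> is nonempty, so is \<open>p2\<close>, which makes it a
      path.\<close>
    with p assms(2) have "is_path V E p2" using is_path_suffix[of V E p1 p2] by auto
    with \<open>map lab p2 = S\<close> show "has_match V E lab S"
      by (auto simp: has_match_def path_label_def)
  qed
qed

section \<open>Reversing the graph and the string\<close>

lemma is_path_rev_imp: "is_path V E p \<Longrightarrow> is_path V (E\<inverse>) (rev p)"
proof -
  assume p: "is_path V E p"
  have "(rev p ! i, rev p ! Suc i) \<in> E\<inverse>" if "Suc i < length p" for i
  proof -
    \<comment> \<open>Edge number \<open>i\<close> of \<open>rev p\<close> is edge number
      \<open>length p - i - 2\<close> of \<open>p\<close>, traversed backwards.\<close>
    have "Suc (length p - Suc (Suc i)) < length p" using that by simp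
    then have "(p ! (length p - Suc (Suc i)), p ! Suc (length p - Suc (Suc i))) \<in> E"
      using p unfolding is_path_def by blast
    moreover have "Suc (length p - Suc (Suc i)) = length p - Suc i" using that by simp
    ultimately show ?thesis using that by (simp add: rev_nth)
  qed
  with p show ?thesis by (auto simp: is_path_def)
qed

lemma is_path_rev: "is_path V (E\<inverse>) (rev p) \<longleftrightarrow> is_path V E p"
  using is_path_rev_imp[of V E p] is_path_rev_imp[of V "E\<inverse>" "rev p"] by auto

lemma has_match_converse: "has_match V (E\<inverse>) lab (rev S) \<longleftrightarrow> has_match V E lab S"
proof
  assume "has_match V (E\<inverse>) lab (rev S)"
  then obtain p where "is_path V (E\<inverse>) p" "map lab p = rev S"
    by (auto simp: has_match_def path_label_def)
  then show "has_match V E lab S"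
    using is_path_rev[of V E "rev p"] unfolding has_match_def path_label_def
    by (intro exI[of _ "rev p"]) (simp add: rev_map[symmetric])
next
  assume "has_match V E lab S"
  then obtain p where "is_path V E p" "map lab p = S"
    by (auto simp: has_match_def path_label_def)
  then show "has_match V (E\<inverse>) lab (rev S)"
    unfolding has_match_def path_label_def
    by (intro exI[of _ "rev p"]) (simp add: is_path_rev rev_map[symmetric])
qed

text \<open>Sinks become sources under reversal, so all counting for \<open>mu_t\<close> reduces to
  that for \<open>mu_s\<close>.\<close>

lemma mu_s_converse: "mu_s V (E\<inverse>) v = mu_t V E v"
proof -
  have src: "is_source V (E\<inverse>) u \<longleftrightarrow> is_sink V E u" for u
    by (simp add: is_source_def is_sink_def in_degree_def out_degree_def)
  have "{p. is_path V (E\<inverse>) p \<and> is_source V (E\<inverse>) (hd p) \<and> last p = v}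
      = rev ` {p. is_path V E p \<and> hd p = v \<and> is_sink V E (last p)}" (is "?X = rev ` ?Y")
  proof (intro set_eqI iffI)
    fix p assume "p \<in> ?X"
    then have "rev p \<in> ?Y"
      using is_path_rev[of V E "rev p"] by (auto simp: src hd_rev last_rev)
    then show "p \<in> rev ` ?Y" by (metis imageI rev_rev_ident)
  qed (auto simp: src is_path_rev hd_rev last_rev)
  then show ?thesis
    unfolding mu_s_def mu_t_def by (simp add: card_image inj_on_def)
qed

lemma min_max_mu_converse:
  "min_max_mu V E = min (Max (mu_s V E ` V)) (Max (mu_s V (E\<inverse>) ` V))"
  by (simp add: min_max_mu_def mu_s_converse[abs_def])

section \<open>Invariance under renaming of vertices and symbols\<close>

lemma is_path_image:
  assumes "inj_on f V" "E \<subseteq> V \<times> V" "set p \<subseteq> V"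
  shows "is_path (f ` V) (map_prod f f ` E) (map f p) \<longleftrightarrow> is_path V E p"
proof -
  have e: "(f x, f y) \<in> map_prod f f ` E \<longleftrightarrow> (x, y) \<in> E" if "x \<in> V" "y \<in> V" for x y
  proof
    assume "(f x, f y) \<in> map_prod f f ` E"
    then obtain a b where ab: "(a, b) \<in> E" "f x = f a" "f y = f b" by auto
    moreover have "a \<in> V" "b \<in> V" using ab(1) assms(2) by auto
    ultimately show "(x, y) \<in> E" using that inj_onD[OF assms(1)] by metis
  qed (metis image_eqI map_prod_simp)
  have "(map f p ! i, map f p ! Suc i) \<in> map_prod f f ` E \<longleftrightarrow> (p ! i, p ! Suc i) \<in> E"
    if "Suc i < length p" for i
    using that assms(3) by (subst e[symmetric]) (auto simp: subset_iff)
  moreover have "distinct (map f p) \<longleftrightarrow> distinct p"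
    using inj_on_subset[OF assms(1,3)] by (simp add: distinct_map)
  ultimately show ?thesis
    using assms(3) by (auto simp: is_path_def)
qed

lemma is_path_image_iff:
  assumes "inj_on f V" "E \<subseteq> V \<times> V"
  shows "is_path (f ` V) (map_prod f f ` E) p \<longleftrightarrow> (\<exists>p'. p = map f p' \<and> is_path V E p')"
proof
  assume p: "is_path (f ` V) (map_prod f f ` E) p"
  then have "set p \<subseteq> f ` V" by (simp add: is_path_def)
  then obtain p' where "set p' \<subseteq> V" "p = map f p'"
    by (intro that[of "map (inv_into V f) p"])
      (auto simp: inv_into_into f_inv_into_f subset_iff intro!: map_idI[symmetric])
  with p show "\<exists>p'. p = map f p' \<and> is_path V E p'"
    using is_path_image[OF assms] by blast
next
  assume "\<exists>p'. p = map f p' \<and> is_path V E p'"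
  then obtain p' where p': "p = map f p'" "is_path V E p'" by blast
  moreover have "set p' \<subseteq> V" using p'(2) by (simp add: is_path_def)
  ultimately show "is_path (f ` V) (map_prod f f ` E) p"
    using is_path_image[OF assms] by blast
qed

text \<open>By injectivity, consecutive edges of a walk in the image meet in the same preimage, so a
  cycle there would pull back to a cycle of \<open>E\<close>.\<close>

lemma dag_image:
  assumes "inj_on f V" "dag V E"
  shows "dag (f ` V) (map_prod f f ` E)"
proof -
  have E: "E \<subseteq> V \<times> V" using assms(2) by (rule dagD)
  have "(x, y) \<in> (map_prod f f ` E)\<^sup>+ \<Longrightarrow> \<exists>u v. x = f u \<and> y = f v \<and> u \<in> V \<and> v \<in> V \<and> (u, v) \<in> E\<^sup>+" for x y
  proof (induction rule: trancl_induct)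
    case (base y)
    then show ?case using E by auto
  next
    case (step y z)
    then obtain u v v' w where "x = f u" "y = f v" "u \<in> V" "v \<in> V" "(u, v) \<in> E\<^sup>+"
      "y = f v'" "z = f w" "(v', w) \<in> E" by auto
    moreover from this have "v' = v" "w \<in> V" using E inj_onD[OF assms(1)] by auto
    ultimately show ?case by (metis trancl.trancl_into_trancl)
  qed
  then have "acyclic (map_prod f f ` E)"
    using dagD(4)[OF assms(2)] inj_onD[OF assms(1)] unfolding acyclic_def by metis
  with assms(2) show ?thesis by (auto simp: dag_def)
qed

lemma is_source_image:
  assumes "inj_on f V" "dag V E" "v \<in> V"
  shows "is_source (f ` V) (map_prod f f ` E) (f v) \<longleftrightarrow> is_source V E v"
proof -
  have "(\<exists>x. (x, f v) \<in> map_prod f f ` E) \<longleftrightarrow> (\<exists>u. (u, v) \<in> E)"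
  proof
    assume "\<exists>x. (x, f v) \<in> map_prod f f ` E"
    then obtain a b where ab: "(a, b) \<in> E" "f v = f b" by auto
    moreover have "b \<in> V" using ab(1) dagD(3)[OF assms(2)] by auto
    ultimately have "v = b" using assms(3) inj_onD[OF assms(1)] by metis
    with ab show "\<exists>u. (u, v) \<in> E" by blast
  qed (metis image_eqI map_prod_simp)
  then show ?thesis
    unfolding is_source_iff[OF assms(2)] is_source_iff[OF dag_image[OF assms(1,2)]]
    using assms(3) by (metis imageI)
qed

lemma mu_s_image:
  assumes "inj_on f V" "dag V E" "v \<in> V"
  shows "mu_s (f ` V) (map_prod f f ` E) (f v) = mu_s V E v"
proof -
  have E: "E \<subseteq> V \<times> V" using assms(2) by (rule dagD)
  let ?P = "\<lambda>p. is_path V E p \<and> is_source V E (hd p) \<and> last p = v"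
  have "(is_source (f ` V) (map_prod f f ` E) (hd (map f p)) \<and> last (map f p) = f v) \<longleftrightarrow>
      is_source V E (hd p) \<and> last p = v" if "is_path V E p" for p
    using is_path_neq_Nil[OF that] is_path_hd_in[OF that] is_path_last_in[OF that] assms
    by (auto simp: hd_map last_map is_source_image dest: inj_onD)
  then have "{p. is_path (f ` V) (map_prod f f ` E) p \<and>
        is_source (f ` V) (map_prod f f ` E) (hd p) \<and> last p = f v} = map f ` Collect ?P"
    unfolding is_path_image_iff[OF assms(1) E] by (intro set_eqI) (auto simp del: list.map_sel)
  moreover have "inj_on (map f) (Collect ?P)"
    by (rule inj_on_subset[of _ "lists V"]) (auto simp: is_path_def inj_on_map_lists[OF assms(1)])
  ultimately show ?thesis by (simp add: mu_s_def card_image)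
qed

lemma min_max_mu_image:
  assumes "inj_on f V" "dag V E"
  shows "min_max_mu (f ` V) (map_prod f f ` E) = min_max_mu V E"
proof -
  have "map_prod f f ` F = {(f a, f b) | a b. (a, b) \<in> F}" for F by auto
  then have c: "(map_prod f f ` E)\<inverse> = map_prod f f ` (E\<inverse>)" by auto
  have "mu_s (f ` V) (map_prod f f ` E') ` f ` V = mu_s V E' ` V" if "dag V E'" for E'
    using mu_s_image[OF assms(1) that] by (simp add: image_image)
  with assms(2) dag_converse[OF assms(2)] show ?thesis
    unfolding min_max_mu_converse c by simp
qed

text \<open>Words over \<open>\<Sigma>\<close> are equal exactly when their images under the
  injective \<open>g\<close> are, so comparing symbol numbers is as good as comparing
  symbols.\<close>

lemma has_match_image:
  assumes "inj_on f V" "dag V E" "inj_on g \<Sigma>" "lab ` V \<subseteq> \<Sigma>" "set S \<subseteq> \<Sigma>"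
    and "\<And>v. v \<in> V \<Longrightarrow> lab' (f v) = g (lab v)"
  shows "has_match (f ` V) (map_prod f f ` E) lab' (map g S) \<longleftrightarrow> has_match V E lab S"
proof -
  have "map lab' (map f p) = map g S \<longleftrightarrow> map lab p = S" if "is_path V E p" for p
  proof -
    have V: "set p \<subseteq> V" using that by (simp add: is_path_def)
    then have "map lab' (map f p) = map g (map lab p)" using assms(6) by auto
    moreover have "inj_on (map g) (lists \<Sigma>)"
      using assms(3) by (rule inj_on_map_lists)
    moreover have "map lab p \<in> lists \<Sigma>" "S \<in> lists \<Sigma>"
      using V assms(4,5) by auto blast
    ultimately show ?thesis by (simp only: inj_on_eq_iff)
  qed
  then show ?thesis
    unfolding has_match_def path_label_def
    unfolding is_path_image_iff[OF assms(1) dagD(3)[OF assms(2)]] by (auto simp del: map_map)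
qed

section \<open>The program\<close>

text \<open>There is no move instruction, so zero is added; the price is that \<open>Tmp\<close> is
  overwritten.\<close>

definition copy :: "reg \<Rightarrow> reg \<Rightarrow> com" where
  "copy x y = Const Tmp 0 ;; Plus x y Tmp"

definition read_header :: com where
  "read_header = Const One 1 ;; Const Tmp 0 ;; Input NumV Tmp ;; Const Tmp 1 ;; Input NumE Tmp ;;
     Const Tmp 2 ;; Input Sig Tmp ;; Const Tmp 3 ;; Input Len Tmp"

text \<open>Prepends cell \<open>Idx\<close> to the list of \<open>u\<close>. Both directions use
  the same cell number for an edge, each in its own arrays.\<close>

definition link :: "bool \<Rightarrow> reg \<Rightarrow> reg \<Rightarrow> com" where
  "link d u v = Read Tmp (Head d) u ;; Write (Next d) Idx Tmp ;; Write (Head d) u Idx ;;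
     Write (Tgt d) Idx v"

definition edge_body :: com where
  "edge_body = Input VertU Ptr ;; Plus Ptr Ptr One ;; Input VertV Ptr ;; Plus Ptr Ptr One ;;
     Plus Idx Idx One ;; link False VertU VertV ;; link True VertV VertU ;; Minus Cnt Cnt One"

definition read_edges :: com where
  "read_edges = (Const Ptr 4 ;; Plus Ptr Ptr NumV ;; Const Idx 0 ;; copy Cnt NumE) ;; While Cnt edge_body"

text \<open>The descending loop counter doubles as the index into the reversed string.\<close>

definition string_body :: com where
  "string_body = Input VertV Ptr ;; Plus Ptr Ptr One ;; Write (Str False) VertU VertV ;;
     Plus VertU VertU One ;; Minus Cnt Cnt One ;; Write (Str True) Cnt VertV"

definition read_string :: com where
  "read_string = (Const VertU 0 ;; copy Cnt Len) ;; While Cnt string_body"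

text \<open>The roots form a list in the same cells as the adjacency lists, behind those of the
  edges. The search can thus start from an ordinary frame that holds all roots.\<close>

definition add_root :: "bool \<Rightarrow> com" where
  "add_root d = Write (Next d) Idx (Root d) ;; Write (Tgt d) Idx VertU ;; copy (Root d) Idx"

definition root_body :: com where
  "root_body = Plus Idx Idx One ;;
     Read Tmp (Head True) VertU ;; IfNZ Tmp Skip (add_root False) ;;
     Read Tmp (Head False) VertU ;; IfNZ Tmp Skip (add_root True) ;;
     Plus VertU VertU One ;; Minus Cnt Cnt One"

definition collect_roots :: com where
  "collect_roots = (Const (Root False) 0 ;; Const (Root True) 0 ;; Const VertU 0 ;; copy Cnt NumV) ;;
     While Cnt root_body"

text \<open>
  A state \<open>q\<close> of the automaton is stored as \<open>q * \<sigma>\<close>, so that no multiplication is needed to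
  address its row of the transition table, which starts at \<open>\<sigma> + q * \<sigma>\<close>. The first row is
  never written and belongs to the failure state of state 0, from which every symbol leads to
  state 0. Row \<open>q\<close> is a copy of the row of the failure state of \<open>q\<close> except at the symbol \<open>S ! q\<close>.
\<close>

definition copy_body :: "bool \<Rightarrow> com" where
  "copy_body d = Read Tmp (Tab d) Src ;; Write (Tab d) Dst Tmp ;; Plus Src Src One ;;
     Plus Dst Dst One ;; Minus Inner Inner One"

definition row_body :: "bool \<Rightarrow> com" where
  "row_body d = (Read Sym (Str d) Idx ;; copy Src Bord ;; copy Dst Row ;; copy Inner Sig) ;;
     While Inner (copy_body d) ;;
     (Plus Tmp Bord Sym ;; Read Tmp (Tab d) Tmp ;; Plus Bord Tmp Sig ;;
      Plus Tmp Row Sym ;; Write (Tab d) Tmp Row ;;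
      copy Row Dst ;; Plus Idx Idx One ;; Minus Cnt Cnt One)"

definition build_table :: "bool \<Rightarrow> com" where
  "build_table d = (copy Row Sig ;; Const Bord 0 ;; Const Idx 0 ;; copy Cnt Len) ;;
     While Cnt (row_body d) ;; Minus Acc Row Sig"

definition init_stack :: "bool \<Rightarrow> com" where
  "init_stack d = Const Tmp 0 ;; Write (StkE d) Tmp (Root d) ;; Write (StkQ d) Tmp Tmp ;;
     Const (Top d) 1"

text \<open>A frame consists of a pointer to the remaining successors and a scaled state. Since no
  state exceeds \<open>Acc\<close>, the truncated difference with \<open>Acc\<close> is zero exactly
  in the accepting state, which makes it an equality test.\<close>

definition advance :: "bool \<Rightarrow> com" where
  "advance d = IfNZ (Top d)
     (Minus Pos (Top d) One ;; Read Edge (StkE d) Pos ;; Read State (StkQ d) Pos ;;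
      IfNZ Edge
        (Read Tmp (Next d) Edge ;; Write (StkE d) Pos Tmp ;; Read VertV (Tgt d) Edge ;;
         Const Tmp 4 ;; Plus Tmp Tmp VertV ;; Input Sym Tmp ;;
         Plus Tmp State Sym ;; Plus Tmp Tmp Sig ;; Read State (Tab d) Tmp ;;
         Minus Tmp Acc State ;;
         IfNZ Tmp
           (Read Edge (Head d) VertV ;; Write (StkE d) (Top d) Edge ;;
            Write (StkQ d) (Top d) State ;; Plus (Top d) (Top d) One)
           (Const Res 1 ;; Const Run 0))
        (Minus (Top d) (Top d) One))
     (Const Run 0)"

definition search :: com where
  "search = (init_stack False ;; init_stack True ;; Const Res 0 ;; Const Run 1) ;;
     While Run (advance False ;; advance True)"

definition main :: com where
  "main = read_header ;;
     IfNZ Len (read_edges ;; read_string ;; collect_roots ;; build_table False ;; build_table True ;;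
       search) Skip"

section \<open>Correctness and running time\<close>

text \<open>
  The bound \<open>b\<close> on the cell numbers of a list makes it insensitive to cells that are allocated
  later; cell number 0 is the null pointer.
\<close>

fun linked :: "(nat \<Rightarrow> nat) \<Rightarrow> (nat \<Rightarrow> nat) \<Rightarrow> nat \<Rightarrow> nat \<Rightarrow> nat list \<Rightarrow> bool" where
  "linked nxt tgt b e [] \<longleftrightarrow> e = 0"
| "linked nxt tgt b e (v # vs) \<longleftrightarrow> 0 < e \<and> e \<le> b \<and> tgt e = v \<and> linked nxt tgt b (nxt e) vs"

lemma linked_update:
  "b < i \<Longrightarrow> linked (nxt(i := x)) (tgt(i := y)) b e vs \<longleftrightarrow> linked nxt tgt b e vs"
  by (induction vs arbitrary: e) auto

lemma linked_mono: "linked nxt tgt b e vs \<Longrightarrow> b \<le> b' \<Longrightarrow> linked nxt tgt b' e vs"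
  by (induction vs arbitrary: e) auto

text \<open>The new cell lies above all cells in use, so writing it leaves existing lists
  intact.\<close>

lemma linked_extend:
  assumes "linked nxt tgt b e vs"
  shows "linked (nxt(Suc b := x)) (tgt(Suc b := y)) (Suc b) e vs"
  using linked_mono[of "nxt(Suc b := x)" "tgt(Suc b := y)" b e vs "Suc b"] assms
  by (simp add: linked_update)

lemma linked_head_iff: "linked nxt tgt b e vs \<Longrightarrow> e = 0 \<longleftrightarrow> vs = []"
  by (cases vs) auto

section \<open>The encoded instance over numbers\<close>

lemma nth_concat_pairs:
  assumes "j < length es"
  shows "concat (map (\<lambda>(u, v). [u, v]) es) ! (2 * j) = fst (es ! j)"
    and "concat (map (\<lambda>(u, v). [u, v]) es) ! Suc (2 * j) = snd (es ! j)"
  using assms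
proof (induction es arbitrary: j)
  case (Cons e es)
  { case 1 then show ?case using Cons.IH by (cases j) (auto split: prod.split) }
  { case 2 then show ?case using Cons.IH by (cases j) (auto split: prod.split) }
qed auto

lemma length_concat_pairs: "length (concat (map (\<lambda>(u, v). [u, v]) es)) = 2 * length es"
  by (induction es) auto

text \<open>The summand \<open>(length S + 3) * \<sigma>\<close> of the bound makes room for the
  transition table, its additional first row and the addresses formed while the last row is
  filled.\<close>

locale match_instance =
  fixes n :: nat and es :: "(nat \<times> nat) list" and \<sigma> :: nat and lab :: "nat \<Rightarrow> nat"
    and S :: "nat list" and w B :: nat
  assumes dag_es: "dag {..<n} (set es)" and distinct_es: "distinct es"
    and lab_less: "\<And>v. v < n \<Longrightarrow> lab v < \<sigma>" and S_less: "\<And>a. a \<in> set S \<Longrightarrow> a < \<sigma>"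
    and n_pos: "0 < n"
    and B_ge: "8 + 2 * n + 2 * length es + length S + (length S + 3) * \<sigma> \<le> B"
    and B_word: "16 * B + 16 + (4 + n + 2 * length es + length S) \<le> 2 ^ w"
begin

abbreviation "ne \<equiv> length es"
abbreviation "m \<equiv> length S"

definition xs :: "nat list" where
  "xs = [n, ne, \<sigma>, m] @ map lab [0..<n] @ concat (map (\<lambda>(u, v). [u, v]) es) @ S"

lemma length_xs: "length xs = 4 + n + 2 * ne + m"
  by (simp add: xs_def length_concat_pairs)

lemma xs_header: "xs ! 0 = n" "xs ! Suc 0 = ne" "xs ! 2 = \<sigma>" "xs ! 3 = m"
  by (simp_all add: xs_def)

lemma xs_lab: "v < n \<Longrightarrow> xs ! (4 + v) = lab v"
  by (simp add: xs_def nth_append)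

lemma xs_edge:
  assumes "j < ne"
  shows "xs ! (4 + n + 2 * j) = fst (es ! j)" "xs ! (5 + (n + 2 * j)) = snd (es ! j)"
  using assms nth_concat_pairs[of j es]
  by (simp_all add: xs_def nth_append length_concat_pairs)

lemma xs_string: "i < m \<Longrightarrow> xs ! (4 + n + 2 * ne + i) = S ! i"
  by (simp add: xs_def nth_append length_concat_pairs)

lemma B_bounds: "8 + 2 * n + 2 * ne + m + 3 * \<sigma> \<le> B"
  using B_ge by (simp add: algebra_simps)

lemma runs_wp: "wp B xs c Q R A \<Longrightarrow> cost c \<le> T \<Longrightarrow> runs w xs c R A T Q"
  using wp_runs[of B xs w c Q R A] runs_mono B_word by (metis length_xs)

definition header :: "regs \<Rightarrow> bool" where
  "header R \<longleftrightarrow> R One = 1 \<and> R NumV = n \<and> R NumE = ne \<and> R Sig = \<sigma> \<and> R Len = m"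

section \<open>The two search directions\<close>

definition edges :: "bool \<Rightarrow> (nat \<times> nat) set" where
  "edges d = (if d then (set es)\<inverse> else set es)"

definition pattern :: "bool \<Rightarrow> nat list" where
  "pattern d = (if d then rev S else S)"

definition tail :: "bool \<Rightarrow> nat \<Rightarrow> nat" where
  "tail d j = (if d then snd (es ! j) else fst (es ! j))"

definition tip :: "bool \<Rightarrow> nat \<Rightarrow> nat" where
  "tip d j = (if d then fst (es ! j) else snd (es ! j))"

text \<open>The newest edge comes first because \<open>link\<close> prepends.\<close>

fun adj :: "bool \<Rightarrow> nat \<Rightarrow> nat \<Rightarrow> nat list" where
  "adj d 0 v = []"
| "adj d (Suc j) v = (if tail d j = v then [tip d j] else []) @ adj d j v"

fun roots :: "bool \<Rightarrow> nat \<Rightarrow> nat list" where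
  "roots d 0 = []"
| "roots d (Suc v) = (if adj (\<not> d) ne v = [] then [v] else []) @ roots d v"

lemma dag_edges: "dag {..<n} (edges d)"
  using dag_es dag_converse by (auto simp: edges_def)

lemma es_less: "j < ne \<Longrightarrow> fst (es ! j) < n" "j < ne \<Longrightarrow> snd (es ! j) < n"
  using dagD(3)[OF dag_es] nth_mem[of j es] by (metis lessThan_iff mem_Sigma_iff prod.collapse subsetD)+

lemma set_adj: "set (adj d j v) = {tip d i | i. i < j \<and> tail d i = v}"
  by (induction j) (auto simp: less_Suc_eq)

lemma set_adj_all: "set (adj d ne v) = edges d `` {v}"
proof -
  have "(v, u) \<in> edges d \<longleftrightarrow> (\<exists>i<ne. tail d i = v \<and> tip d i = u)" for u
    by (cases d) (auto simp: edges_def tail_def tip_def in_set_conv_nth prod_eq_iff)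
  then show ?thesis unfolding set_adj by auto
qed

text \<open>A repeated edge would make the search traverse the same path twice. Distinctness turns
  sums over successor lists into sums over successor sets.\<close>

lemma distinct_adj: "j \<le> ne \<Longrightarrow> distinct (adj d j v)"
proof (induction j)
  case (Suc j)
  have "tip d j \<noteq> tip d i" if "tail d j = v" "tail d i = v" "i < j" for i
  proof
    assume "tip d j = tip d i"
    with that have "es ! i = es ! j"
      by (auto simp: tip_def tail_def prod_eq_iff split: if_splits)
    then show False using distinct_es Suc.prems that(3) by (simp add: nth_eq_iff_index_eq)
  qed
  with Suc show ?case by (auto simp: set_adj)
qed simp

text \<open>The list of the opposite direction contains the predecessors of a vertex, so its
  emptiness characterises sources.\<close>

lemma set_roots: "k \<le> n \<Longrightarrow> set (roots d k) = {v. v < k \<and> is_source {..<n} (edges d) v}"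
proof (induction k)
  case (Suc k)
  have "adj (\<not> d) ne k = [] \<longleftrightarrow> is_source {..<n} (edges d) k"
    using set_adj_all[of "\<not> d" k] Suc.prems unfolding is_source_iff[OF dag_edges]
    by (auto simp: edges_def simp flip: set_empty)
  with Suc show ?case by (auto simp: less_Suc_eq)
qed simp

lemma distinct_roots: "distinct (roots d k)"
proof -
  have "v < k" if "v \<in> set (roots d k)" for v k
    using that by (induction k) (auto split: if_splits simp: less_Suc_eq)
  then show ?thesis by (induction k) fastforce+
qed

section \<open>Reading edges and string, collecting the roots\<close>

definition adjacency :: "nat \<Rightarrow> nat \<Rightarrow> arrs \<Rightarrow> bool" where
  "adjacency j b A \<longleftrightarrow> (\<forall>d. \<forall>v<n. linked (A (Next d)) (A (Tgt d)) b (A (Head d) v) (adj d j v))"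

text \<open>The clause on \<open>Tab\<close> carries the initial zeros of the memory along to the
  table construction, where they form the failure row of state 0.\<close>

definition edge_inv :: "regs \<Rightarrow> arrs \<Rightarrow> nat \<Rightarrow> bool" where
  "edge_inv R A k \<longleftrightarrow> header R \<and> R Cnt = k \<and> k \<le> ne \<and> R Idx = ne - k \<and>
     R Ptr = 4 + n + 2 * (ne - k) \<and> adjacency (ne - k) (ne - k) A \<and> (\<forall>d i. A (Tab d) i = 0)"

text \<open>The bound 100, like the other fixed step bounds below, is a rounded-up value of
  \<open>cost\<close>.\<close>

lemma edge_step:
  assumes "edge_inv R A (Suc k)"
  shows "runs w xs edge_body R A 100 (\<lambda>R' A'. edge_inv R' A' k)"
proof (rule runs_wp)
  define j where "j = ne - Suc k"
  have j: "j < ne" "ne - Suc k = j" "ne - k = Suc j" "k \<le> ne"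
    using assms by (auto simp: j_def edge_inv_def)
  have R: "R One = 1" "R NumV = n" "R NumE = ne" "R Sig = \<sigma>" "R Len = m" "R Cnt = Suc k"
    "R Idx = j" "R Ptr = 4 + n + 2 * j" and A: "adjacency j j A" "\<And>d i. A (Tab d) i = 0"
    using assms by (auto simp: edge_inv_def j header_def)
  have lk: "linked (A (Next d)) (A (Tgt d)) j (A (Head d) v) (adj d j v)" if "v < n" for d v
    using A(1) that by (simp add: adjacency_def)
  note ext = linked_extend[OF lk]
  show "wp B xs edge_body (\<lambda>R' A'. edge_inv R' A' k) R A"
    unfolding edge_body_def link_def
    using B_bounds j R A(2) es_less[OF j(1)] xs_edge[OF j(1)]
    by (simp add: edge_inv_def header_def adjacency_def all_bool_eq length_xs tail_def tip_def
        ext lk linked_update)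
qed (simp add: edge_body_def link_def)

lemma runs_read_edges:
  assumes "header R" "\<And>a i. A a i = 0"
  shows "runs w xs read_edges R A (102 * ne + 10) (\<lambda>R' A'. edge_inv R' A' 0)"
proof -
  have "runs w xs (Const Ptr 4 ;; Plus Ptr Ptr NumV ;; Const Idx 0 ;; copy Cnt NumE) R A 5
      (\<lambda>R' A'. edge_inv R' A' ne)"
    by (rule runs_wp) (use assms B_bounds in \<open>simp_all add: edge_inv_def header_def adjacency_def copy_def\<close>)
  then show ?thesis unfolding read_edges_def
    by (rule runs_init_count_down[where I = edge_inv, OF _ edge_step]) (auto simp: edge_inv_def)
qed

definition string_inv :: "regs \<Rightarrow> arrs \<Rightarrow> nat \<Rightarrow> bool" where
  "string_inv R A k \<longleftrightarrow> header R \<and> R Cnt = k \<and> k \<le> m \<and> R Idx = ne \<and> R VertU = m - k \<and>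
     R Ptr = 4 + n + 2 * ne + (m - k) \<and> adjacency ne ne A \<and> (\<forall>d i. A (Tab d) i = 0) \<and>
     (\<forall>i<m - k. A (Str False) i = S ! i \<and> A (Str True) (m - Suc i) = S ! i)"

lemma string_step:
  assumes "string_inv R A (Suc k)"
  shows "runs w xs string_body R A 30 (\<lambda>R' A'. string_inv R' A' k)"
proof (rule runs_wp)
  define j where "j = m - Suc k"
  have j: "j < m" "m - Suc k = j" "m - k = Suc j" "k \<le> m" "m - Suc j = k"
    using assms by (auto simp: j_def string_inv_def)
  have "R One = 1" "R NumV = n" "R NumE = ne" "R Sig = \<sigma>" "R Len = m" "R Cnt = Suc k" "R Idx = ne"
    "R VertU = j" "R Ptr = 4 + n + 2 * ne + j" "adjacency ne ne A" "\<And>d i. A (Tab d) i = 0"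
    "\<And>i. i < j \<Longrightarrow> A (Str False) i = S ! i \<and> A (Str True) (m - Suc i) = S ! i"
    using assms by (auto simp: string_inv_def j header_def)
  then show "wp B xs string_body (\<lambda>R' A'. string_inv R' A' k) R A"
    unfolding string_body_def
    using B_bounds j xs_string[OF j(1)]
    by (auto simp: string_inv_def header_def adjacency_def length_xs less_Suc_eq)
qed (simp add: string_body_def)

lemma runs_read_string:
  assumes "edge_inv R A 0"
  shows "runs w xs read_string R A (32 * m + 10) (\<lambda>R' A'. string_inv R' A' 0)"
proof -
  have "runs w xs (Const VertU 0 ;; copy Cnt Len) R A 3 (\<lambda>R' A'. string_inv R' A' m)"
    by (rule runs_wp)
      (use assms B_bounds in \<open>simp_all add: edge_inv_def string_inv_def header_def copy_def\<close>)
  then show ?thesis unfolding read_string_def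
    by (rule runs_init_count_down[where I = string_inv, OF _ string_step]) (auto simp: string_inv_def)
qed

definition pattern_stored :: "arrs \<Rightarrow> bool" where
  "pattern_stored A \<longleftrightarrow> (\<forall>d. \<forall>i<m. A (Str d) i = pattern d ! i)"

lemma string_inv_stored: "string_inv R A 0 \<Longrightarrow> pattern_stored A"
  unfolding pattern_stored_def
proof (intro allI impI)
  fix d i assume inv: "string_inv R A 0" and i: "i < m"
  have str: "\<And>i. i < m \<Longrightarrow> A (Str False) i = S ! i" "\<And>i. i < m \<Longrightarrow> A (Str True) (m - Suc i) = S ! i"
    using inv by (simp_all add: string_inv_def)
  from i str(1)[of i] str(2)[of "m - Suc i"] show "A (Str d) i = pattern d ! i" by (cases d) (simp_all add: pattern_def rev_nth)
qed

text \<open>One cell number is reserved for every vertex, whether or not it turns out to be a root;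
  hence \<open>Idx\<close> is a function of the loop counter.\<close>

definition root_inv :: "regs \<Rightarrow> arrs \<Rightarrow> nat \<Rightarrow> bool" where
  "root_inv R A k \<longleftrightarrow> header R \<and> R Cnt = k \<and> k \<le> n \<and> R Idx = ne + (n - k) \<and> R VertU = n - k \<and>
     adjacency ne (ne + (n - k)) A \<and> (\<forall>d i. A (Tab d) i = 0) \<and> pattern_stored A \<and>
     (\<forall>d. linked (A (Next d)) (A (Tgt d)) (ne + (n - k)) (R (Root d)) (roots d (n - k)))"

lemma root_step:
  assumes "root_inv R A (Suc k)"
  shows "runs w xs root_body R A 70 (\<lambda>R' A'. root_inv R' A' k)"
proof (rule runs_wp)
  define j where "j = n - Suc k"
  have j: "j < n" "n - Suc k = j" "n - k = Suc j" "k \<le> n"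
    using assms by (auto simp: j_def root_inv_def)
  have R: "R One = 1" "R NumV = n" "R NumE = ne" "R Sig = \<sigma>" "R Len = m" "R Cnt = Suc k"
    "R Idx = ne + j" "R VertU = j" and A: "\<And>d i. A (Tab d) i = 0" "pattern_stored A"
    using assms by (auto simp: root_inv_def j header_def)
  have lk: "linked (A (Next d)) (A (Tgt d)) (ne + j) (A (Head d) v) (adj d ne v)" if "v < n" for d v
    using assms that by (simp add: root_inv_def adjacency_def j)
  have rt: "linked (A (Next d)) (A (Tgt d)) (ne + j) (R (Root d)) (roots d j)" for d
    using assms by (simp add: root_inv_def j)
  note ext = linked_extend[OF lk] linked_extend[OF rt]
  \<comment> \<open>Serves the direction in which the vertex is no root: the bound grows although no
    cell is written.\<close>
  have mono: "linked (A (Next d)) (A (Tgt d)) (Suc (ne + j)) (A (Head d) v) (adj d ne v)"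
    "linked (A (Next d)) (A (Tgt d)) (Suc (ne + j)) (R (Root d)) (roots d j)" if "v < n" for d v
    using linked_mono[OF lk[OF that]] linked_mono[OF rt] by auto
  have hd: "A (Head d) j = 0 \<longleftrightarrow> adj d ne j = []" for d
    using linked_head_iff[OF lk[OF j(1)]] .
  show "wp B xs root_body (\<lambda>R' A'. root_inv R' A' k) R A"
    unfolding root_body_def add_root_def copy_def
    using B_bounds j R A
    by (simp add: root_inv_def header_def adjacency_def pattern_stored_def all_bool_eq hd
        ext lk rt mono linked_update n_pos)
qed (simp add: root_body_def add_root_def copy_def)

lemma runs_collect_roots:
  assumes "string_inv R A 0"
  shows "runs w xs collect_roots R A (72 * n + 10) (\<lambda>R' A'. root_inv R' A' 0)"
proof -
  have "runs w xs (Const (Root False) 0 ;; Const (Root True) 0 ;; Const VertU 0 ;; copy Cnt NumV) R A 5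
      (\<lambda>R' A'. root_inv R' A' n)"
    by (rule runs_wp)
      (use assms B_bounds string_inv_stored[OF assms] in
        \<open>simp_all add: string_inv_def root_inv_def header_def copy_def all_bool_eq\<close>)
  then show ?thesis unfolding collect_roots_def
    by (rule runs_init_count_down[where I = root_inv, OF _ root_step]) (auto simp: root_inv_def)
qed


section \<open>Filling the transition table\<close>

lemma length_pattern [simp]: "length (pattern d) = m"
  by (simp add: pattern_def)

lemma pattern_less: "q < m \<Longrightarrow> pattern d ! q < \<sigma>"
  using S_less[OF nth_mem] by (simp add: pattern_def rev_nth)

definition rows_filled :: "bool \<Rightarrow> nat \<Rightarrow> (nat \<Rightarrow> nat) \<Rightarrow> bool" where
  "rows_filled d q T \<longleftrightarrow> (\<forall>p<q. \<forall>a<\<sigma>. T (\<sigma> + p * \<sigma> + a) = delta (pattern d) p a * \<sigma>)"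

text \<open>By \<open>delta_mismatch\<close>, row \<open>q\<close> differs from the row at
  \<open>r\<close> only at the symbol that continues the pattern. The first conjunct places the row
  at \<open>r\<close> before row \<open>q\<close>, so the copy does not overwrite its own
  source.\<close>

definition failure_row :: "bool \<Rightarrow> nat \<Rightarrow> (nat \<Rightarrow> nat) \<Rightarrow> nat \<Rightarrow> bool" where
  "failure_row d q T r \<longleftrightarrow> r + \<sigma> \<le> \<sigma> + q * \<sigma> \<and>
     (\<forall>a<\<sigma>. T (r + a) = overlap (pattern d) (tl (take q (pattern d) @ [a])) * \<sigma>)"

text \<open>At the matching symbol the entry \<open>\<sigma> + q * \<sigma>\<close> is the scaled
  state \<open>Suc q\<close>; the same number is the address of row \<open>q\<close>, so the program
  can store the row pointer itself.\<close>

lemma rows_filled_Suc: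
  assumes "q < m" "rows_filled d q T" "failure_row d q T r"
    and old: "\<And>i. i < \<sigma> + q * \<sigma> \<Longrightarrow> T' i = T i"
    and new: "\<And>a. a < \<sigma> \<Longrightarrow>
      T' (\<sigma> + q * \<sigma> + a) = (if a = pattern d ! q then \<sigma> + q * \<sigma> else T (r + a))"
  shows "rows_filled d (Suc q) T'"
  unfolding rows_filled_def
proof (intro allI impI)
  fix p a assume p: "p < Suc q" and a: "a < \<sigma>"
  show "T' (\<sigma> + p * \<sigma> + a) = delta (pattern d) p a * \<sigma>"
  proof (cases "p = q")
    case True
    then show ?thesis
      using new[OF a] a assms(1,3) delta_match[of q "pattern d"] delta_mismatch[of q "pattern d" a]
      by (auto simp: failure_row_def)
  next
    case False
    then have "Suc p * \<sigma> \<le> q * \<sigma>" using p by (intro mult_le_mono) auto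
    then have "\<sigma> + p * \<sigma> + a < \<sigma> + q * \<sigma>" using a by simp
    with old assms(2) False p a show ?thesis by (auto simp: rows_filled_def)
  qed
qed

text \<open>The failure state of \<open>Suc q\<close> is at most \<open>q\<close>, so its row is
  already complete. Appending a symbol commutes with \<open>tl\<close> on the nonempty prefix, which
  turns the claim into one transition of that failure state.\<close>

lemma failure_row_Suc:
  assumes "q < m" "rows_filled d (Suc q) T"
  shows "failure_row d (Suc q) T (overlap (pattern d) (tl (take (Suc q) (pattern d))) * \<sigma> + \<sigma>)"
proof -
  let ?P = "pattern d"
  let ?u = "tl (take (Suc q) ?P)"
  have le: "overlap ?P ?u \<le> q" using overlap_le_length[of ?P ?u] by simp
  then have "overlap ?P ?u * \<sigma> \<le> q * \<sigma>" by simp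
  moreover have "T (overlap ?P ?u * \<sigma> + \<sigma> + a) = overlap ?P (tl (take (Suc q) ?P @ [a])) * \<sigma>"
    if "a < \<sigma>" for a
  proof -
    have "length (take (Suc q) ?P) \<noteq> 0" using assms(1) by simp
    then have "take (Suc q) ?P \<noteq> []" by (metis list.size(3))
    then have "overlap ?P (tl (take (Suc q) ?P @ [a])) = delta ?P (overlap ?P ?u) a"
      by (simp add: overlap_snoc)
    then show ?thesis
      using assms(2) le that by (auto simp: rows_filled_def add.commute)
  qed
  ultimately show ?thesis by (simp add: failure_row_def)
qed

text \<open>\<open>R0\<close> and \<open>A0\<close> are a snapshot taken when the copy loop starts;
  everything but the copied row and four registers agrees with it.\<close>

definition copy_inv :: "bool \<Rightarrow> regs \<Rightarrow> arrs \<Rightarrow> regs \<Rightarrow> arrs \<Rightarrow> nat \<Rightarrow> bool" where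
  "copy_inv d R0 A0 R A k \<longleftrightarrow> R Inner = k \<and> k \<le> \<sigma> \<and> R Src = R0 Bord + (\<sigma> - k) \<and>
     R Dst = R0 Row + (\<sigma> - k) \<and>
     (\<forall>r. r \<notin> {Inner, Src, Dst, Tmp} \<longrightarrow> R r = R0 r) \<and> (\<forall>a. a \<noteq> Tab d \<longrightarrow> A a = A0 a) \<and>
     (\<forall>i<R0 Row. A (Tab d) i = A0 (Tab d) i) \<and>
     (\<forall>a<\<sigma> - k. A (Tab d) (R0 Row + a) = A0 (Tab d) (R0 Bord + a))"

lemma copy_step:
  assumes "copy_inv d R0 A0 R A (Suc k)" "R0 One = 1" "R0 Bord + \<sigma> \<le> R0 Row" "R0 Row + \<sigma> < B"
  shows "runs w xs (copy_body d) R A 20 (\<lambda>R' A'. copy_inv d R0 A0 R' A' k)"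
proof (rule runs_wp)
  define j where "j = \<sigma> - Suc k"
  have j: "j < \<sigma>" "\<sigma> - Suc k = j" "\<sigma> - k = Suc j" "k \<le> \<sigma>"
    using assms by (auto simp: j_def copy_inv_def)
  have "R One = 1" "R Inner = Suc k" "R Src = R0 Bord + j" "R Dst = R0 Row + j"
    "\<And>r. r \<notin> {Inner, Src, Dst, Tmp} \<Longrightarrow> R r = R0 r" "\<And>a. a \<noteq> Tab d \<Longrightarrow> A a = A0 a"
    "\<And>i. i < R0 Row \<Longrightarrow> A (Tab d) i = A0 (Tab d) i"
    "\<And>a. a < j \<Longrightarrow> A (Tab d) (R0 Row + a) = A0 (Tab d) (R0 Bord + a)"
    using assms(1,2) by (auto simp: copy_inv_def j)
  then show "wp B xs (copy_body d) (\<lambda>R' A'. copy_inv d R0 A0 R' A' k) R A"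
    unfolding copy_body_def
    using j assms(3,4) by (simp add: copy_inv_def less_Suc_eq)
qed (simp add: copy_body_def)

definition row_inv :: "bool \<Rightarrow> regs \<Rightarrow> arrs \<Rightarrow> regs \<Rightarrow> arrs \<Rightarrow> nat \<Rightarrow> bool" where
  "row_inv d R0 A0 R A k \<longleftrightarrow> header R \<and> R Cnt = k \<and> k \<le> m \<and> R Idx = m - k \<and>
     R Row = \<sigma> + (m - k) * \<sigma> \<and> (\<forall>c. R (Root c) = R0 (Root c)) \<and> (\<forall>a. a \<noteq> Tab d \<longrightarrow> A a = A0 a) \<and>
     rows_filled d (m - k) (A (Tab d)) \<and> failure_row d (m - k) (A (Tab d)) (R Bord)"

lemma row_step:
  assumes inv: "row_inv d R0 A0 R A (Suc k)" and str: "pattern_stored A0"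
  shows "runs w xs (row_body d) R A (22 * \<sigma> + 60) (\<lambda>R' A'. row_inv d R0 A0 R' A' k)"
proof -
  define q where "q = m - Suc k"
  have q: "q < m" "m - Suc k = q" "m - k = Suc q" "k \<le> m"
    using inv by (auto simp: q_def row_inv_def)
  have R: "header R" "R Cnt = Suc k" "R Idx = q" "R Row = \<sigma> + q * \<sigma>" "\<And>c. R (Root c) = R0 (Root c)"
    and A: "\<And>a. a \<noteq> Tab d \<Longrightarrow> A a = A0 a" "rows_filled d q (A (Tab d))"
    "failure_row d q (A (Tab d)) (R Bord)"
    using inv by (auto simp: row_inv_def q)
  have "q * \<sigma> \<le> m * \<sigma>" using q(1) by (intro mult_le_mono) auto
  moreover have "(m + 3) * \<sigma> = m * \<sigma> + 3 * \<sigma>" by (rule distrib_right)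
  ultimately have bnd: "\<sigma> + q * \<sigma> + \<sigma> + \<sigma> < B" "m + \<sigma> < B" using B_ge by linarith+
  have brd: "R Bord + \<sigma> \<le> \<sigma> + q * \<sigma>" using A(3) by (simp add: failure_row_def)
  have sym: "A (Str d) q = pattern d ! q" using A(1) str q(1) by (simp add: pattern_stored_def)
  \<comment> \<open>The registers at the start of the copy loop; the zero in \<open>Tmp\<close> is
    left behind by \<open>copy\<close>.\<close>
  define R1 where "R1 = R(Sym := pattern d ! q, Tmp := 0, Src := R Bord, Dst := R Row, Inner := \<sigma>)"
  have "runs w xs (Read Sym (Str d) Idx ;; copy Src Bord ;; copy Dst Row ;; copy Inner Sig) R A 14
      (\<lambda>R' A'. copy_inv d R1 A R' A' \<sigma>)"
    by (rule runs_wp)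
      (use R(1-4) brd bnd q(1) sym in \<open>simp_all add: copy_def copy_inv_def header_def R1_def\<close>)
  moreover have "runs w xs (While Inner (copy_body d)) R' A' ((20 + 2) * \<sigma> + 1)
      (\<lambda>R' A'. copy_inv d R1 A R' A' 0)" if "copy_inv d R1 A R' A' \<sigma>" for R' A'
    using that R(1,4) brd bnd
    by (intro runs_count_down[where I = "copy_inv d R1 A"] copy_step)
      (auto simp: R1_def header_def copy_inv_def)
  moreover have "runs w xs
     (Plus Tmp Bord Sym ;; Read Tmp (Tab d) Tmp ;; Plus Bord Tmp Sig ;;
      Plus Tmp Row Sym ;; Write (Tab d) Tmp Row ;;
      copy Row Dst ;; Plus Idx Idx One ;; Minus Cnt Cnt One) R' A' 40
      (\<lambda>R' A'. row_inv d R0 A0 R' A' k)" if inv': "copy_inv d R1 A R' A' 0" for R' A'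
  proof (rule runs_wp)
    let ?c = "pattern d ! q"
    let ?x = "overlap (pattern d) (tl (take (Suc q) (pattern d)))"
    let ?T = "(A' (Tab d))(\<sigma> + q * \<sigma> + ?c := \<sigma> + q * \<sigma>)"
    have c: "?c < \<sigma>" using q(1) by (rule pattern_less)
    have R': "R' One = 1" "R' NumV = n" "R' NumE = ne" "R' Sig = \<sigma>" "R' Len = m" "R' Cnt = Suc k"
      "R' Idx = q" "R' Row = \<sigma> + q * \<sigma>" "\<And>c. R' (Root c) = R0 (Root c)" "R' Bord = R Bord"
      "R' Sym = ?c" "R' Dst = \<sigma> + q * \<sigma> + \<sigma>"
      and A': "\<And>a. a \<noteq> Tab d \<Longrightarrow> A' a = A0 a" "\<And>i. i < \<sigma> + q * \<sigma> \<Longrightarrow> A' (Tab d) i = A (Tab d) i"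
      "\<And>a. a < \<sigma> \<Longrightarrow> A' (Tab d) (\<sigma> + q * \<sigma> + a) = A (Tab d) (R Bord + a)"
      using inv' R A(1) by (auto simp: copy_inv_def R1_def header_def)
    \<comment> \<open>The failure row lies below row \<open>q\<close> and is untouched by the copy.
      Its entry at the pattern symbol is the scaled failure state of \<open>Suc q\<close>, so
      failure states come for free with the table.\<close>
    have "A' (Tab d) (R Bord + ?c) = A (Tab d) (R Bord + ?c)" using brd c by (intro A'(2)) simp
    also have "\<dots> = ?x * \<sigma>"
      using A(3) c q(1) by (simp add: failure_row_def take_Suc_conv_app_nth)
    finally have fail: "A' (Tab d) (R Bord + ?c) = ?x * \<sigma>" .
    have "?x \<le> q" using overlap_le_length[of "pattern d" "tl (take (Suc q) (pattern d))"] by simp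
    then have "?x * \<sigma> \<le> q * \<sigma>" by simp
    then have x: "?x * \<sigma> + \<sigma> < B" using bnd(1) by linarith
    have rows: "rows_filled d (Suc q) ?T"
      by (rule rows_filled_Suc[OF q(1) A(2,3)]) (auto simp: A'(2,3))
    note frow = failure_row_Suc[OF q(1) rows]
    show "wp B xs
     (Plus Tmp Bord Sym ;; Read Tmp (Tab d) Tmp ;; Plus Bord Tmp Sig ;;
      Plus Tmp Row Sym ;; Write (Tab d) Tmp Row ;;
      copy Row Dst ;; Plus Idx Idx One ;; Minus Cnt Cnt One) (\<lambda>R' A'. row_inv d R0 A0 R' A' k) R' A'"
      using R' A'(1) fail x bnd brd c q rows frow
      by (simp add: copy_def row_inv_def header_def)
  qed (simp add: copy_def)
  ultimately have "runs w xs (row_body d) R A (14 + ((20 + 2) * \<sigma> + 1 + 40))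
      (\<lambda>R' A'. row_inv d R0 A0 R' A' k)"
    unfolding row_body_def by (intro runs_Seq) blast+
  then show ?thesis by (rule runs_mono) auto
qed

lemma runs_build_table:
  assumes "header R" "pattern_stored A" "\<And>i. A (Tab d) i = 0"
  shows "runs w xs (build_table d) R A (m * (22 * \<sigma> + 62) + 20)
    (\<lambda>R' A'. header R' \<and> (\<forall>c. R' (Root c) = R (Root c)) \<and> (\<forall>a. a \<noteq> Tab d \<longrightarrow> A' a = A a) \<and>
       R' Acc = m * \<sigma> \<and> rows_filled d m (A' (Tab d)))"
proof -
  have "runs w xs (copy Row Sig ;; Const Bord 0 ;; Const Idx 0 ;; copy Cnt Len) R A 10
      (\<lambda>R' A'. row_inv d R A R' A' m)"
    by (rule runs_wp) (use assms(1,3) B_bounds in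
      \<open>simp_all add: copy_def row_inv_def header_def rows_filled_def failure_row_def\<close>)
  moreover have "runs w xs (While Cnt (row_body d)) R' A' ((22 * \<sigma> + 60 + 2) * m + 1)
      (\<lambda>R' A'. row_inv d R A R' A' 0)" if "row_inv d R A R' A' m" for R' A'
    using that assms(2)
    by (intro runs_count_down[where I = "row_inv d R A"] row_step) (auto simp: row_inv_def)
  moreover have "runs w xs (Minus Acc Row Sig) R' A' 1 (\<lambda>R' A'. header R' \<and>
       (\<forall>c. R' (Root c) = R (Root c)) \<and> (\<forall>a. a \<noteq> Tab d \<longrightarrow> A' a = A a) \<and>
       R' Acc = m * \<sigma> \<and> rows_filled d m (A' (Tab d)))" if "row_inv d R A R' A' 0" for R' A'
    using that by (intro runs_wp) (simp_all add: row_inv_def header_def)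
  ultimately have "runs w xs (build_table d) R A (10 + ((22 * \<sigma> + 60 + 2) * m + 1 + 1))
    (\<lambda>R' A'. header R' \<and> (\<forall>c. R' (Root c) = R (Root c)) \<and> (\<forall>a. a \<noteq> Tab d \<longrightarrow> A' a = A a) \<and>
       R' Acc = m * \<sigma> \<and> rows_filled d m (A' (Tab d)))"
    unfolding build_table_def by (intro runs_Seq) blast+
  then show ?thesis by (rule runs_mono) (auto simp: algebra_simps)
qed


section \<open>The two interleaved searches\<close>

definition prepared :: "bool \<Rightarrow> regs \<Rightarrow> arrs \<Rightarrow> bool" where
  "prepared d R A \<longleftrightarrow> header R \<and> R Acc = m * \<sigma> \<and> rows_filled d m (A (Tab d)) \<and>
     (\<forall>v<n. linked (A (Next d)) (A (Tgt d)) (ne + n) (A (Head d) v) (adj d ne v))"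

text \<open>
  A frame \<open>(vs, q)\<close> holds the vertices that are still to be appended to the path of the frames
  below it, whose labels lead the automaton to \<open>q\<close>. As heights decrease along edges, the condition
  on heights bounds the depth of the stack.
\<close>

fun stacked :: "bool \<Rightarrow> arrs \<Rightarrow> (nat list \<times> nat) list \<Rightarrow> bool" where
  "stacked d A [] \<longleftrightarrow> True"
| "stacked d A ((vs, q) # fs) \<longleftrightarrow>
     linked (A (Next d)) (A (Tgt d)) (ne + n) (A (StkE d) (length fs)) vs \<and>
     A (StkQ d) (length fs) = q * \<sigma> \<and> q < m \<and>
     (\<forall>v\<in>set vs. v < n \<and> height (edges d) v + length fs \<le> n) \<and> stacked d A fs"

text \<open>The bottom frame holds the roots, and each further frame belongs to a vertex of the
  current path, which gives up to \<open>Suc n\<close> frames.\<close>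

definition on_stack :: "bool \<Rightarrow> regs \<Rightarrow> arrs \<Rightarrow> (nat list \<times> nat) list \<Rightarrow> bool" where
  "on_stack d R A fs \<longleftrightarrow> R (Top d) = length fs \<and> length fs \<le> Suc n \<and> stacked d A fs"

text \<open>Some unexplored path leads to acceptance. A search step that neither stops nor succeeds
  preserves this truth value, so it equals the answer throughout.\<close>

definition pending :: "bool \<Rightarrow> (nat list \<times> nat) list \<Rightarrow> bool" where
  "pending d fs \<longleftrightarrow>
     (\<exists>(vs, q)\<in>set fs. \<exists>v\<in>set vs. accepts_from {..<n} (edges d) lab (pattern d) q v)"

text \<open>Each remaining path costs one step to open its frame and one step to close it.\<close>

definition potential :: "bool \<Rightarrow> (nat list \<times> nat) list \<Rightarrow> nat" where
  "potential d fs =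
     (\<Sum>(vs, q)\<leftarrow>fs. Suc (2 * (\<Sum>v\<leftarrow>vs. num_paths_from {..<n} (edges d) v)))"

lemma stacked_cong:
  assumes "A' (Next d) = A (Next d)" "A' (Tgt d) = A (Tgt d)"
    and "\<And>i. i < length fs \<Longrightarrow> A' (StkE d) i = A (StkE d) i"
    and "\<And>i. i < length fs \<Longrightarrow> A' (StkQ d) i = A (StkQ d) i"
  shows "stacked d A' fs \<longleftrightarrow> stacked d A fs"
  using assms(3,4) by (induction fs) (auto simp: assms(1,2))

lemma num_paths_from_adj:
  assumes "v < n"
  shows "num_paths_from {..<n} (edges d) v =
    Suc (\<Sum>u\<leftarrow>adj d ne v. num_paths_from {..<n} (edges d) u)"
  using num_paths_from_rec[OF dag_edges, of v d] assms distinct_adj[of ne d v]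
  by (simp add: set_adj_all sum_list_distinct_conv_sum_set)

lemma accepts_from_adj:
  assumes "v < n"
  shows "accepts_from {..<n} (edges d) lab (pattern d) q v \<longleftrightarrow>
    delta (pattern d) q (lab v) = m \<or>
    (\<exists>u\<in>set (adj d ne v). accepts_from {..<n} (edges d) lab (pattern d) (delta (pattern d) q (lab v)) u)"
  using accepts_from_rec[OF dag_edges, of v d lab "pattern d" q] assms by (simp add: set_adj_all)

text \<open>The outcomes are exhaustion, success and an ordinary step. The unchanged registers and
  arrays include all that the other search relies on.\<close>

definition advanced :: "bool \<Rightarrow> regs \<Rightarrow> arrs \<Rightarrow> (nat list \<times> nat) list \<Rightarrow> regs \<Rightarrow> arrs \<Rightarrow> bool" where
  "advanced d R A fs R' A' \<longleftrightarrow>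
     (\<forall>r\<in>{One, NumV, NumE, Sig, Len, Acc, Top (\<not> d)}. R' r = R r) \<and>
     (\<forall>a. a \<notin> {StkE d, StkQ d} \<longrightarrow> A' a = A a) \<and>
     (fs = [] \<and> R' Run = 0 \<and> R' Res = R Res \<or>
      pending d fs \<and> R' Run = 0 \<and> R' Res = 1 \<or>
      R' Run = R Run \<and> R' Res = R Res \<and>
        (\<exists>fs'. on_stack d R' A' fs' \<and> potential d fs' < potential d fs \<and>
           (pending d fs' \<longleftrightarrow> pending d fs)))"

text \<open>Closing an empty frame lowers the potential by 1. Expanding \<open>v\<close> removes
  twice its number of paths, that is 2 plus twice the paths of its successors, and adds 1 plus the
  latter for the new frame, again a loss of 1.\<close>

lemma runs_advance:
  assumes P: "prepared d R A" and St: "on_stack d R A fs"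
  shows "runs w xs (advance d) R A 150 (advanced d R A fs)"
proof (rule runs_wp)
  have R: "R One = 1" "R NumV = n" "R NumE = ne" "R Sig = \<sigma>" "R Len = m" "R Acc = m * \<sigma>"
    using P by (auto simp: prepared_def header_def)
  have top: "R (Top d) = length fs" using St by (simp add: on_stack_def)
  show "wp B xs (advance d) (advanced d R A fs) R A"
  proof (cases fs)
    case Nil
    with top B_bounds show ?thesis by (simp add: advance_def advanced_def)
  next
    case (Cons f gs)
    obtain vs q where f: "f = (vs, q)" by (cases f)
    have st: "linked (A (Next d)) (A (Tgt d)) (ne + n) (A (StkE d) (length gs)) vs"
      "A (StkQ d) (length gs) = q * \<sigma>" "q < m" "stacked d A gs"
      and vs: "\<And>v. v \<in> set vs \<Longrightarrow> v < n \<and> height (edges d) v + length gs \<le> n"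
      using St by (auto simp: on_stack_def Cons f)
    have len: "R (Top d) = Suc (length gs)" "length gs \<le> n"
      using St top by (simp_all add: on_stack_def Cons)
    show ?thesis
    proof (cases vs)
      case Nil
      have "on_stack d (R(Pos := length gs, Edge := 0, State := q * \<sigma>, Top d := length gs)) A gs"
        using st len by (simp add: on_stack_def)
      moreover have "potential d gs < potential d fs" "pending d gs \<longleftrightarrow> pending d fs"
        by (auto simp: potential_def pending_def Cons f Nil)
      ultimately show ?thesis
        using st Nil len R B_bounds by (auto simp: advance_def advanced_def Cons)
    next
      case vs_Cons: (Cons v us)
      define e where "e = A (StkE d) (length gs)"
      define q' where "q' = delta (pattern d) q (lab v)"
      have v: "v < n" "height (edges d) v + length gs \<le> n" using vs[of v] by (auto simp: vs_Cons)
      have e: "0 < e" "e \<le> ne + n" "A (Tgt d) e = v"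
        "linked (A (Next d)) (A (Tgt d)) (ne + n) (A (Next d) e) us"
        using st(1) by (auto simp: vs_Cons e_def)
      have "A (Tab d) (\<sigma> + q * \<sigma> + lab v) = q' * \<sigma>"
        using P st(3) lab_less[OF v(1)] by (simp add: prepared_def rows_filled_def q'_def)
      then have tab: "A (Tab d) (q * \<sigma> + lab v + \<sigma>) = q' * \<sigma>" by (simp add: ac_simps)
      have "q * \<sigma> \<le> m * \<sigma>" using st(3) by (intro mult_le_mono) auto
      moreover have "(m + 3) * \<sigma> = m * \<sigma> + 3 * \<sigma>" by (rule distrib_right)
      ultimately have bnd: "q * \<sigma> + lab v + \<sigma> < B" "q * \<sigma> + lab v < B"
        using B_ge lab_less[OF v(1)] by linarith+
      \<comment> \<open>For positive \<open>\<sigma>\<close>, scaled states compare exactly like the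
        states themselves.\<close>
      have \<sigma>: "0 < \<sigma>" using lab_less[OF v(1)] by simp
      have q': "q' \<le> m" using delta_le[of "pattern d"] by (simp add: q'_def)
      show ?thesis
      proof (cases "q' = m")
        case True
        then have "pending d fs"
          using accepts_from_adj[OF v(1)] by (auto simp: pending_def Cons f vs_Cons q'_def)
        then show ?thesis
          using True tab bnd e(1-3) st(2) len R v B_bounds xs_lab[OF v(1)]
          by (simp add: advance_def advanced_def length_xs flip: e_def)
      next
        case False
        then have q'm: "q' < m" using q' by simp
        define fs' where "fs' = (adj d ne v, q') # (us, q) # gs"
        \<comment> \<open>Symbolic execution first yields only the raw effect on registers and
          arrays; the reasoning about stacks is kept apart from it by
          \<open>wp_mono\<close>.\<close>
        have "wp B xs (advance d) (\<lambda>R' A'.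
            (\<forall>r\<in>{One, NumV, NumE, Sig, Len, Acc, Top (\<not> d), Run, Res}. R' r = R r) \<and>
            R' (Top d) = length gs + 2 \<and> (\<forall>a. a \<notin> {StkE d, StkQ d} \<longrightarrow> A' a = A a) \<and>
            A' (StkE d) = (A (StkE d))(length gs := A (Next d) e, Suc (length gs) := A (Head d) v) \<and>
            A' (StkQ d) = (A (StkQ d))(Suc (length gs) := q' * \<sigma>)) R A"
          using q'm \<sigma> tab bnd e(1-3) st(2) len R v B_bounds xs_lab[OF v(1)]
          by (simp add: advance_def length_xs flip: e_def)
        then show ?thesis
        proof (rule wp_mono)
          fix R' A'
          assume h: "(\<forall>r\<in>{One, NumV, NumE, Sig, Len, Acc, Top (\<not> d), Run, Res}. R' r = R r) \<and>
            R' (Top d) = length gs + 2 \<and> (\<forall>a. a \<notin> {StkE d, StkQ d} \<longrightarrow> A' a = A a) \<and>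
            A' (StkE d) = (A (StkE d))(length gs := A (Next d) e, Suc (length gs) := A (Head d) v) \<and>
            A' (StkQ d) = (A (StkQ d))(Suc (length gs) := q' * \<sigma>)"
          have "stacked d A' gs \<longleftrightarrow> stacked d A gs"
            using h by (intro stacked_cong) auto
          moreover have "linked (A (Next d)) (A (Tgt d)) (ne + n) (A (Head d) v) (adj d ne v)"
            using P v(1) by (simp add: prepared_def)
          moreover have "u < n \<and> height (edges d) u + Suc (length gs) \<le> n"
            if "u \<in> set (adj d ne v)" for u
          proof -
            have "(v, u) \<in> edges d" using that set_adj_all[of d v] by blast
            then show ?thesis
              using height_less[OF dag_edges] v(2) dagD(3)[OF dag_edges, of d] by fastforce
          qed
          \<comment> \<open>The height of \<open>v\<close> is positive, so the depth leaves room for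
            one more frame.\<close>
          moreover have "Suc (length gs) \<le> n"
            using height_pos[OF dag_edges, of v d] v by simp
          ultimately have "on_stack d R' A' fs'"
            using h st e(4) vs q'm by (simp add: on_stack_def fs'_def vs_Cons)
          moreover have "potential d fs' < potential d fs"
            using num_paths_from_adj[OF v(1), of d] by (simp add: potential_def fs'_def Cons f vs_Cons)
          moreover have "pending d fs' \<longleftrightarrow> pending d fs"
            using accepts_from_adj[OF v(1), of d q] False
            by (auto simp: pending_def fs'_def Cons f vs_Cons q'_def)
          ultimately show "advanced d R A fs R' A'" using h by (auto simp: advanced_def)
        qed
      qed
    qed
  qed
qed (simp add: advance_def)


abbreviation "matching \<equiv> has_match {..<n} (set es) lab S"

lemma advanced_prepared: "advanced d R A fs R' A' \<Longrightarrow> prepared c R' A' \<longleftrightarrow> prepared c R A"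
  by (simp add: advanced_def prepared_def header_def)

lemma advanced_on_stack:
  assumes "advanced d R A fs R' A'" "c = (\<not> d)"
  shows "on_stack c R' A' gs \<longleftrightarrow> on_stack c R A gs"
proof -
  have "stacked c A' gs \<longleftrightarrow> stacked c A gs"
    using assms by (intro stacked_cong) (auto simp: advanced_def)
  with assms show ?thesis by (auto simp: on_stack_def advanced_def)
qed

lemma advanced_cases:
  assumes "advanced d R A fs R' A'"
  obtains (empty) "fs = []" "R' Run = 0" "R' Res = R Res"
    | (found) "pending d fs" "R' Run = 0" "R' Res = 1"
    | (go) fs' where "R' Run = R Run" "R' Res = R Res" "on_stack d R' A' fs'"
      "potential d fs' < potential d fs" "pending d fs' \<longleftrightarrow> pending d fs"
proof -
  have "fs = [] \<and> R' Run = 0 \<and> R' Res = R Res \<or>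
      pending d fs \<and> R' Run = 0 \<and> R' Res = 1 \<or>
      R' Run = R Run \<and> R' Res = R Res \<and>
        (\<exists>fs'. on_stack d R' A' fs' \<and> potential d fs' < potential d fs \<and>
           (pending d fs' \<longleftrightarrow> pending d fs))"
    using assms unfolding advanced_def by (elim conjE)
  then show thesis using empty found go by (elim disjE conjE exE)
qed

text \<open>Each stack by itself determines the answer, so either search may be the one that
  finishes. The index bounds the smaller potential strictly, and it need not be stored by the
  program.\<close>

definition search_inv :: "regs \<Rightarrow> arrs \<Rightarrow> nat \<Rightarrow> bool" where
  "search_inv R A k \<longleftrightarrow> (\<forall>d. prepared d R A) \<and>
     (R Run = 0 \<and> R Res = (if matching then 1 else 0) \<or>
      R Run = 1 \<and> R Res = 0 \<and>
      (\<exists>fs gs. on_stack False R A fs \<and> on_stack True R A gs \<and>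
         (pending False fs \<longleftrightarrow> matching) \<and> (pending True gs \<longleftrightarrow> matching) \<and>
         min (potential False fs) (potential True gs) < k))"

lemma search_step:
  assumes "search_inv R A k" "R Run \<noteq> 0"
  shows "runs w xs (advance False ;; advance True) R A (150 + 150) (\<lambda>R' A'. \<exists>k'<k. search_inv R' A' k')"
proof -
  obtain fs gs where P: "\<And>d. prepared d R A" and R: "R Run = 1" "R Res = 0"
    and fs: "on_stack False R A fs" "pending False fs \<longleftrightarrow> matching"
    and gs: "on_stack True R A gs" "pending True gs \<longleftrightarrow> matching"
    and k: "min (potential False fs) (potential True gs) < k"
    using assms by (auto simp: search_inv_def)
  have nil: "\<not> pending d []" for d by (simp add: pending_def)
  show ?thesis
  proof (rule runs_Seq[OF runs_advance[OF P fs(1)]])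
    fix R1 A1 assume 1: "advanced False R A fs R1 A1"
    have gs1: "on_stack True R1 A1 gs" using advanced_on_stack[OF 1, of True] gs(1) by simp
    have P1: "prepared d R1 A1" for d using advanced_prepared[OF 1] P by simp
    show "runs w xs (advance True) R1 A1 150 (\<lambda>R' A'. \<exists>k'<k. search_inv R' A' k')"
    proof (rule runs_mono[OF runs_advance[OF P1 gs1] order_refl])
      fix R2 A2 assume 2: "advanced True R1 A1 gs R2 A2"
      have P2: "prepared d R2 A2" for d using advanced_prepared[OF 2] P1 by simp
      have stop: "\<exists>k'<k. search_inv R2 A2 k'" if "R2 Run = 0" "R2 Res = (if matching then 1 else 0)"
        using that P2 k by (intro exI[of _ 0]) (simp add: search_inv_def)
      from 1 show "\<exists>k'<k. search_inv R2 A2 k'"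
      proof (cases rule: advanced_cases)
        \<comment> \<open>After the first search has stopped, the second still takes one step. It
          cannot spoil the result: success would mean that a match exists, which the exhausted first
          stack refutes.\<close>
        case empty
        with 2 show ?thesis using nil fs(2) gs(2) R
          by (cases rule: advanced_cases) (auto intro!: stop)
      next
        case found
        with 2 show ?thesis using fs(2) R
          by (cases rule: advanced_cases) (auto intro!: stop)
      next
        case go1: (go fs')
        from 2 show ?thesis
        proof (cases rule: advanced_cases)
          case empty
          with go1 R show ?thesis using nil gs(2) by (auto intro!: stop)
        next
          case found
          with gs(2) show ?thesis by (auto intro!: stop)
        next
          case go2: (go gs')
          have "on_stack False R2 A2 fs'" using advanced_on_stack[OF 2, of False] go1(3) by simp
          \<comment> \<open>Both potentials have dropped, whichever of them was the smaller
            one.\<close>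
          moreover have "min (potential False fs') (potential True gs') < k - 1"
            using go1(4) go2(4) k by linarith
          ultimately have "search_inv R2 A2 (k - 1)"
            using go1 go2 P2 fs(2) gs(2) R unfolding search_inv_def by auto
          then show ?thesis using k by (intro exI[of _ "k - 1"]) auto
        qed
      qed
    qed
  qed
qed

lemma pending_roots:
  assumes "0 < m"
  shows "pending d [(roots d n, 0)] \<longleftrightarrow> matching"
proof -
  have "pending d [(roots d n, 0)] \<longleftrightarrow> has_match {..<n} (edges d) lab (pattern d)"
    using has_match_iff_accepts[OF dag_edges, of "pattern d" d lab] assms set_roots[of n d]
    by (auto simp: pending_def is_source_def pattern_def)
  also have "\<dots> \<longleftrightarrow> matching"
    by (simp add: edges_def pattern_def has_match_converse)
  finally show ?thesis .
qed

lemma potential_roots: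
  "potential d [(roots d n, 0)] \<le> 2 * (n * Max (mu_s {..<n} (edges d) ` {..<n})) + 1"
proof -
  have "set (roots d n) = {s. is_source {..<n} (edges d) s}"
    using set_roots[of n d] by (auto simp: is_source_def)
  then have "(\<Sum>v\<leftarrow>roots d n. num_paths_from {..<n} (edges d) v) = (\<Sum>v<n. mu_s {..<n} (edges d) v)"
    using sum_num_paths_from_sources[OF dag_edges, of d]
    by (simp add: sum_list_distinct_conv_sum_set distinct_roots)
  also have "\<dots> \<le> n * Max (mu_s {..<n} (edges d) ` {..<n})"
    using sum_mu_s_le[of "{..<n}" "edges d"] by simp
  finally show ?thesis by (simp add: potential_def)
qed

lemma runs_search:
  assumes "0 < m" "\<And>d. prepared d R A"
    and roots: "\<And>d. linked (A (Next d)) (A (Tgt d)) (ne + n) (R (Root d)) (roots d n)"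
  shows "runs w xs search R A (604 * (n * min_max_mu {..<n} (set es)) + 1000)
    (\<lambda>R' A'. R' Res = (if matching then 1 else 0))"
proof -
  \<comment> \<open>One more than the bound of \<open>potential_roots\<close>, as
    \<open>search_inv\<close> asks for strict inequality. A round costs at most 150 + 150 + 2 steps,
    and the factor 2 in \<open>k\<close> turns 302 into 604.\<close>
  define k where "k = 2 * (n * min_max_mu {..<n} (set es)) + 2"
  have "min_max_mu {..<n} (set es) = Max (mu_s {..<n} (edges False) ` {..<n}) \<or>
      min_max_mu {..<n} (set es) = Max (mu_s {..<n} (edges True) ` {..<n})"
    unfolding min_max_mu_converse edges_def by auto
  then have k: "min (potential False [(roots False n, 0)]) (potential True [(roots True n, 0)]) < k"
    using potential_roots[of False] potential_roots[of True] unfolding k_def by (auto simp: min_def)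
  have st: "on_stack d R' A' [(roots d n, 0)]" if "R' (Top d) = 1" "A' (Next d) = A (Next d)"
    "A' (Tgt d) = A (Tgt d)" "A' (StkE d) 0 = R (Root d)" "A' (StkQ d) 0 = 0" for R' A' d
    using that assms(1) roots[of d] set_roots[of n d] height_le[OF dag_edges, of _ d]
    by (simp add: on_stack_def is_source_def)
  have "runs w xs (init_stack False ;; init_stack True ;; Const Res 0 ;; Const Run 1) R A 40
      (\<lambda>R' A'. search_inv R' A' k)"
  proof (rule runs_wp)
    have "wp B xs (init_stack False ;; init_stack True ;; Const Res 0 ;; Const Run 1)
        (\<lambda>R' A'. (\<forall>d. prepared d R' A') \<and> R' Run = 1 \<and> R' Res = 0 \<and>
           on_stack False R' A' [(roots False n, 0)] \<and> on_stack True R' A' [(roots True n, 0)]) R A"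
      using assms(2) B_bounds by (simp add: init_stack_def prepared_def header_def st)
    then show "wp B xs (init_stack False ;; init_stack True ;; Const Res 0 ;; Const Run 1)
        (\<lambda>R' A'. search_inv R' A' k) R A"
      by (rule wp_mono) (use k pending_roots[OF assms(1)] in \<open>unfold search_inv_def, blast\<close>)
  qed (simp add: init_stack_def)
  from runs_Seq[OF this runs_While[where I = search_inv, OF search_step]]
  have "runs w xs search R A (40 + ((150 + 150 + 2) * k + 1))
      (\<lambda>R' A'. R' Run = 0 \<and> (\<exists>k'. search_inv R' A' k'))"
    unfolding search_def by blast
  then show ?thesis
    by (rule runs_mono) (auto simp: search_inv_def k_def)
qed

lemma min_max_mu_pos: "0 < min_max_mu {..<n} (set es)"
proof -
  have "0 < Max (mu_s {..<n} (edges d) ` {..<n})" for d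
    using Max_mu_s_pos[OF dag_edges] n_pos by auto
  from this[of False] this[of True] show ?thesis
    unfolding min_max_mu_converse edges_def by simp
qed

lemma runs_main:
  "runs w xs main (\<lambda>_. 0) (\<lambda>_ _. 0)
     (2000 * ((n + ne) * min_max_mu {..<n} (set es) + \<sigma> * m))
     (\<lambda>R' A'. R' Res = (if matching then 1 else 0))"
proof -
  let ?k = "min_max_mu {..<n} (set es)"
  let ?Q = "\<lambda>R' A'. R' Res = (if matching then 1 else 0)"
  let ?T = "102 * ne + 10 + (32 * m + 10 + (72 * n + 10 + (m * (22 * \<sigma> + 62) + 20 +
    (m * (22 * \<sigma> + 62) + 20 + (604 * (n * ?k) + 1000)))))"
  have 1: "runs w xs read_header (\<lambda>_. 0) (\<lambda>_ _. 0) 9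
      (\<lambda>R A. header R \<and> (\<forall>a i. A a i = 0) \<and> R Res = 0)"
    by (rule runs_wp)
      (use B_bounds in \<open>simp_all add: read_header_def header_def length_xs xs_header\<close>)
  have 2: "runs w xs (read_edges ;; read_string ;; collect_roots ;; build_table False ;;
      build_table True ;; search) R A ?T ?Q"
    if "header R" "\<forall>a i. A a i = 0" "R Len \<noteq> 0" for R A
  proof -
    have m: "0 < m" using that by (simp add: header_def)
    have tab2: "runs w xs (build_table True ;; search) R1 A1
        (m * (22 * \<sigma> + 62) + 20 + (604 * (n * ?k) + 1000)) ?Q"
      if r: "root_inv R A 0" and h: "header R1 \<and> (\<forall>c. R1 (Root c) = R (Root c)) \<and>
        (\<forall>a. a \<noteq> Tab False \<longrightarrow> A1 a = A a) \<and> R1 Acc = m * \<sigma> \<and> rows_filled False m (A1 (Tab False))"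
      for R A R1 A1
    proof (rule runs_Seq[OF runs_build_table])
      show "header R1" "pattern_stored A1" "A1 (Tab True) i = 0" for i
        using r h by (simp_all add: root_inv_def pattern_stored_def)
      fix R2 A2
      assume "header R2 \<and> (\<forall>c. R2 (Root c) = R1 (Root c)) \<and>
        (\<forall>a. a \<noteq> Tab True \<longrightarrow> A2 a = A1 a) \<and> R2 Acc = m * \<sigma> \<and> rows_filled True m (A2 (Tab True))"
      with r h have "prepared False R2 A2" "prepared True R2 A2"
        "linked (A2 (Next d)) (A2 (Tgt d)) (ne + n) (R2 (Root d)) (roots d n)" for d
        by (simp_all add: root_inv_def prepared_def adjacency_def)
      then show "runs w xs search R2 A2 (604 * (n * ?k) + 1000) ?Q"
        using m by (intro runs_search) (metis (full_types))+
    qed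
    have tab1: "runs w xs (build_table False ;; build_table True ;; search) R A
        (m * (22 * \<sigma> + 62) + 20 + (m * (22 * \<sigma> + 62) + 20 + (604 * (n * ?k) + 1000))) ?Q"
      if r: "root_inv R A 0" for R A
    proof (rule runs_Seq[OF runs_build_table])
      show "header R" "pattern_stored A" "A (Tab False) i = 0" for i
        using r by (simp_all add: root_inv_def)
    qed (rule tab2[OF r])
    have "runs w xs read_edges R A (102 * ne + 10) (\<lambda>R' A'. edge_inv R' A' 0)"
      using that(1,2) by (intro runs_read_edges) auto
    then show ?thesis
      by (rule runs_Seq[OF _ runs_Seq[OF runs_read_string runs_Seq[OF runs_collect_roots tab1]]])
  qed
  have 3: "?Q R A" if "header R" "R Res = 0" "R Len = 0" for R and A :: arrs
  proof -
    have "S = []" using that by (simp add: header_def)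
    then have "\<not> matching" by (auto simp: has_match_def path_label_def is_path_def)
    with that show ?thesis by simp
  qed
  have "runs w xs main (\<lambda>_. 0) (\<lambda>_ _. 0) (9 + (2 + (?T + 0))) ?Q"
    unfolding main_def
  proof (rule runs_Seq[OF 1], rule runs_IfNZ)
    fix R and A :: arrs assume h: "header R \<and> (\<forall>a i. A a i = 0) \<and> R Res = 0"
    show "R Len \<noteq> 0 \<Longrightarrow> runs w xs (read_edges ;; read_string ;; collect_roots ;; build_table False ;;
      build_table True ;; search) R A ?T ?Q" using 2 h by blast
    show "R Len = 0 \<Longrightarrow> runs w xs Skip R A 0 ?Q" using 3[of R] h by (intro runs_wp) simp_all
  qed
  moreover have "9 + (2 + (?T + 0)) \<le> 2000 * ((n + ne) * ?k + \<sigma> * m)"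
  proof -
    have "0 < \<sigma>" using lab_less[OF n_pos] by simp
    \<comment> \<open>The label of a vertex makes \<open>\<sigma>\<close> positive, and the maxima
      are positive; thus every lower-order term, including the constant, is dominated by a term of
      the bound.\<close>
    then have le: "m \<le> \<sigma> * m" "ne \<le> ne * ?k" "n \<le> n * ?k" "1 \<le> n * ?k"
      using min_max_mu_pos n_pos by simp_all
    have eq: "m * (22 * \<sigma> + 62) = 22 * (\<sigma> * m) + 62 * m" "(n + ne) * ?k = n * ?k + ne * ?k"
      by (simp_all add: algebra_simps)
    \<comment> \<open>Products are replaced by variables, which leaves a linear inequality.\<close>
    have "9 + (2 + (102 * e + 10 + (32 * l + 10 + (72 * v + 10 + (22 * c + 62 * l + 20 +
        (22 * c + 62 * l + 20 + (604 * a + 1000))))) + 0)) \<le> 2000 * (a + b + c)"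
      if "l \<le> c" "e \<le> b" "v \<le> a" "1 \<le> a" for a b c l v e :: nat
      using that by simp
    from this[OF le] show ?thesis unfolding eq .
  qed
  ultimately show ?thesis by (rule runs_mono) auto
qed

end

section \<open>From the structured program to the machine\<close>

text \<open>Array addresses presuppose the input length in register 2; it is summed up here from the
  header, counting every edge twice and the header as 4.\<close>

definition prologue :: program where
  "prologue = [LoadConst 1 0, Load 2 1, LoadConst 1 1, Load 0 1, Add 2 2 0, Add 2 2 0,
     LoadConst 1 3, Load 0 1, Add 2 2 0, LoadConst 1 4, Add 2 2 1]"

text \<open>Register 0 serves as scratch space until the end, so the result is moved there from
  \<open>Res\<close> only by the last two instructions.\<close>

definition match_program :: program where
  "match_program = prologue @ compile main (length prologue) @
     [LoadConst 1 0, Add 0 (reg_no Res) 1]"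

lemma prologue_exec:
  assumes "length xs = xs ! 0 + 2 * xs ! 1 + xs ! 3 + 4" "length xs < 2 ^ w"
  shows "\<exists>R M. fold (exec_instr w) prologue (init_config xs) = (length prologue, R, M) \<and>
    represents xs (\<lambda>_. 0) (\<lambda>_ _. 0) R M"
proof -
  define M where "M = (\<lambda>i. if i < length xs then xs ! i else 0)"
  define a b c where "a = xs ! 0" and "b = xs ! 1" and "c = xs ! 3"
  have len: "length xs = a + 2 * b + c + 4" using assms(1) by (simp add: a_def b_def c_def)
  have M: "M 0 = a" "M (Suc 0) = b" "M 3 = c"
    using len by (simp_all add: M_def a_def b_def c_def)
  have "a + b < 2 ^ w" "a + b + b < 2 ^ w" "a + b + b + c < 2 ^ w" "a + b + b + c + 4 < 2 ^ w"
    "1 < (2 :: nat) ^ w" "3 < (2 :: nat) ^ w" "4 < (2 :: nat) ^ w"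
    using assms(2) unfolding len by linarith+
  note bounds = this
  have "0 < w" using bounds(5) by (cases w) simp_all
  with bounds have "fold (exec_instr w) prologue (0, \<lambda>_. 0, M)
      = (length prologue, (\<lambda>_. 0)(0 := c, Suc 0 := 4, 2 := length xs), M)"
    using M by (simp add: prologue_def fun_eq_iff len)
  moreover have "represents xs (\<lambda>_. 0) (\<lambda>_ _. 0) ((\<lambda>_. 0)(0 := c, Suc 0 := 4, 2 := length xs)) M"
    by (simp add: represents_def M_def)
  ultimately show ?thesis by (simp add: init_config_def M_def)
qed

lemma prologue_no_jump: "i \<in> set prologue \<Longrightarrow> \<not> is_jump i"
  by (auto simp: prologue_def)

text \<open>The 13 additional steps are the eleven instructions of \<open>prologue\<close> and the
  two that move the result.\<close>

lemma decides_withinI: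
  assumes "runs w xs main (\<lambda>_. 0) (\<lambda>_ _. 0) T (\<lambda>R A. R Res = (if b then 1 else 0))"
    and "length xs = xs ! 0 + 2 * xs ! 1 + xs ! 3 + 4" "length xs < 2 ^ w" "T + 13 \<le> T'"
  shows "decides_within w match_program xs T' b"
proof -
  let ?p = match_program
  let ?epi = "[LoadConst 1 0, Add 0 (reg_no Res) 1]"
  let ?q = "length prologue" and ?c = "compile main (length prologue)"
  obtain R M where 1: "fold (exec_instr w) prologue (init_config xs) = (?q, R, M)"
    "represents xs (\<lambda>_. 0) (\<lambda>_ _. 0) R M"
    using prologue_exec[OF assms(2,3)] by blast
  have s1: "(step w ?p ^^ ?q) (init_config xs) = (?q, R, M)"
    using straight_line_steps[of prologue ?p "[]" "?c @ ?epi" 0 w] 1(1)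
    unfolding init_config_def by (simp add: match_program_def prologue_no_jump)
  obtain t R1 A1 R2 M2 where 2: "t \<le> T" "(step w ?p ^^ t) (?q, R, M) = (?q + length ?c, R2, M2)"
    "represents xs R1 A1 R2 M2" "R1 Res = (if b then 1 else 0)"
    using runsD[OF assms(1) 1(2) match_program_def refl] by blast
  have "1 < (2 :: nat) ^ w" using assms(2,3) by simp
  then have "fold (exec_instr w) ?epi (?q + length ?c, R2, M2)
      = (?q + length ?c + 2, R2(1 := 0, 0 := R1 Res), M2)"
    using 2(4) represents_reg[OF 2(3), of Res] by auto
  then have s3: "(step w ?p ^^ 2) (?q + length ?c, R2, M2)
      = (?q + length ?c + 2, R2(1 := 0, 0 := R1 Res), M2)"
    using straight_line_steps[of ?epi ?p "prologue @ ?c" "[]" "?q + length ?c" w R2 M2]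
    by (simp add: match_program_def numeral_2_eq_2)
  have "(step w ?p ^^ (2 + (t + ?q))) (init_config xs)
      = (?q + length ?c + 2, R2(1 := 0, 0 := R1 Res), M2)"
    using s1 2(2) s3 by (simp only: funpow_add o_apply)
  moreover have "2 + (t + ?q) \<le> T'" using 2(1) assms(4) by (simp add: prologue_def)
  moreover have "halted ?p (?q + length ?c + 2, R2(1 := 0, 0 := R1 Res), M2)"
    by (simp add: halted_def match_program_def)
  moreover have "(R2(1 := 0, 0 := R1 Res)) 0 = (if b then 1 else 0)" using 2(4) by simp
  ultimately show ?thesis unfolding decides_within_def by blast
qed

section \<open>Numbering vertices and symbols\<close>

lemma index_in_less: "x \<in> set xs \<Longrightarrow> index_in xs x < length xs"
  by (induction xs) (auto simp: index_in_def)

lemma nth_index_in: "x \<in> set xs \<Longrightarrow> xs ! index_in xs x = x"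
  by (induction xs) (auto simp: index_in_def)

lemma index_in_nth: "distinct xs \<Longrightarrow> i < length xs \<Longrightarrow> index_in xs (xs ! i) = i"
  using nth_index_in[of "xs ! i" xs] index_in_less[of "xs ! i" xs]
  by (simp add: nth_eq_iff_index_eq)

lemma inj_on_index_in: "inj_on (index_in xs) (set xs)"
  by (metis inj_onI nth_index_in)

lemma index_in_image: "distinct xs \<Longrightarrow> index_in xs ` set xs = {..<length xs}"
  using index_in_less[of _ xs] index_in_nth[of xs] by (force simp: set_conv_nth)

theorem theorem1:
  "\<exists>(P :: program) (c :: nat) (d :: nat).
     \<forall>(V :: 'v set) (E :: ('v \<times> 'v) set) (\<Sigma> :: 'a set) (lab :: 'v \<Rightarrow> 'a) (S :: 'a list)
      (vs :: 'v list) (es :: ('v \<times> 'v) list) (as :: 'a list) (w :: nat).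
       dag V E \<and> V \<noteq> {} \<and> finite \<Sigma> \<and> lab ` V \<subseteq> \<Sigma> \<and> set S \<subseteq> \<Sigma> \<and>
       distinct vs \<and> set vs = V \<and> distinct es \<and> set es = E \<and> distinct as \<and> set as = \<Sigma> \<and>
       (card V + card E + card \<Sigma> + length S) ^ d \<le> 2 ^ w
       \<longrightarrow> decides_within w P (encode_instance vs es as lab S)
             (c * ((card V + card E) * min_max_mu V E + card \<Sigma> * length S))
             (has_match V E lab S)"
proof (rule exI[of _ match_program], rule exI[of _ 2013], rule exI[of _ 9],
    intro allI impI, elim conjE)
  fix V :: "'v set" and E :: "('v \<times> 'v) set" and \<Sigma> :: "'a set" and lab S vs es as w
  assume dag: "dag V E" and ne: "V \<noteq> {}" and lab: "lab ` V \<subseteq> \<Sigma>" and S: "set S \<subseteq> \<Sigma>"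
    and vs: "distinct vs" "set vs = V" and es: "distinct es" "set es = E"
    and as: "distinct as" "set as = \<Sigma>"
    and w: "(card V + card E + card \<Sigma> + length S) ^ 9 \<le> 2 ^ w"
  define n where "n = length vs"
  define f where "f = index_in vs"
  define g where "g = index_in as"
  define es' where "es' = map (map_prod f f) es"
  define lab' where "lab' = (\<lambda>i. g (lab (vs ! i)))"
  define S' where "S' = map g S"
  define \<sigma> where "\<sigma> = length as"
  define B where "B = 8 + 2 * n + 2 * length es' + length S' + (length S' + 3) * \<sigma>"
  have card: "card V = n" "card E = length es'" "card \<Sigma> = \<sigma>" "length S = length S'"
    using vs es as distinct_card by (auto simp: n_def es'_def S'_def \<sigma>_def)
  have inj: "inj_on f V" "inj_on g \<Sigma>"
    using inj_on_index_in vs(2) as(2) by (auto simp: f_def g_def)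
  have img: "f ` V = {..<n}" using index_in_image[OF vs(1)] vs(2) by (simp add: f_def n_def)
  have E': "set es' = map_prod f f ` E" by (simp add: es'_def es)
  have lab': "lab' (f v) = g (lab v)" if "v \<in> V" for v
    using that nth_index_in[of v vs] vs(2) by (simp add: lab'_def f_def)
  have g: "g a < \<sigma>" if "a \<in> \<Sigma>" for a
    using that index_in_less[of a as] as(2) by (simp add: g_def \<sigma>_def)
  have lab_less: "lab' i < \<sigma>" if "i < n" for i
    using that nth_mem[of i vs] vs(2) lab by (auto simp: lab'_def n_def intro!: g)
  have n: "0 < n" using ne vs(2) by (auto simp: n_def)
  define Z where "Z = n + length es' + \<sigma> + length S'"
  \<comment> \<open>A vertex and its label contribute at least one each.\<close>
  have Z: "2 \<le> Z" using n lab_less[of 0] by (simp add: Z_def)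
  have ZZ: "2 * Z \<le> Z * Z" "4 \<le> Z * Z" using Z mult_le_mono[OF Z Z] by simp_all
  \<comment> \<open>The table size is the only quadratic part of \<open>B\<close>; linear terms and
    constants are absorbed by \<open>2 * Z\<close> and 4 being at most \<open>Z * Z\<close>.\<close>
  have "length S' * \<sigma> \<le> Z * Z" by (intro mult_le_mono) (simp_all add: Z_def)
  moreover have "16 * (8 + 2 * v + 2 * e + l + (x + 3 * s)) + 16 + (4 + v + 2 * e + l) \<le> 128 * z"
    if "x \<le> z" "2 * y \<le> z" "4 \<le> z" "y = v + e + s + l" for v e l x y z s :: nat
    using that by simp
  ultimately have "16 * B + 16 + (4 + n + 2 * length es' + length S') \<le> 128 * (Z * Z)"
    using ZZ Z_def unfolding B_def distrib_right by blast
  \<comment> \<open>Since 128 is the seventh power of 2 and \<open>Z\<close> is at least 2, the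
    factor is bounded by \<open>Z ^ 7\<close>; together with the quadratic part this explains the
    exponent 9.\<close>
  also have "\<dots> \<le> Z ^ 7 * (Z * Z)" using power_mono[OF Z, of 7] by (intro mult_le_mono) simp_all
  also have "\<dots> = Z ^ 9" by (simp add: eval_nat_numeral)
  also have "\<dots> \<le> 2 ^ w" using w by (simp add: card Z_def)
  finally have Bw: "16 * B + 16 + (4 + n + 2 * length es' + length S') \<le> 2 ^ w" .
  interpret match_instance n es' \<sigma> lab' S' w B
  proof
    show "dag {..<n} (set es')" unfolding E' img[symmetric] by (rule dag_image[OF inj(1) dag])
    have "inj_on (map_prod f f) (set es)"
      using inj_on_subset[OF map_prod_inj_on[OF inj(1) inj(1)] dagD(3)[OF dag]] by (simp add: es(2))
    then show "distinct es'" using es(1) by (simp add: es'_def distinct_map)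
    show "a < \<sigma>" if "a \<in> set S'" for a using that S g by (auto simp: S'_def)
  qed (use lab_less n Bw in \<open>simp_all add: B_def\<close>)
  have "map (\<lambda>v. index_in as (lab v)) vs = map lab' [0..<n]"
    by (rule nth_equalityI) (simp_all add: n_def lab'_def g_def)
  then have enc: "encode_instance vs es as lab S = xs"
    unfolding xs_def
    by (simp add: encode_instance_def n_def es'_def S'_def \<sigma>_def f_def g_def map_prod_def
        case_prod_unfold comp_def)
  have k: "min_max_mu {..<n} (set es') = min_max_mu V E"
    unfolding E' img[symmetric] by (rule min_max_mu_image[OF inj(1) dag])
  have hm: "has_match {..<n} (set es') lab' S' \<longleftrightarrow> has_match V E lab S"
    unfolding E' img[symmetric] S'_def
    by (rule has_match_image[OF inj(1) dag inj(2) lab S lab'])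
  define T where "T = (n + length es') * min_max_mu V E + \<sigma> * length S'"
  have "1 \<le> (n + length es') * min_max_mu V E"
    using n min_max_mu_pos by (simp add: k)
  then have "1 \<le> T" unfolding T_def by (rule trans_le_add1)
  \<comment> \<open>The 13 steps outside the structured program are absorbed by \<open>T\<close>
    being at least 1, which gives the constant 2013.\<close>
  then have "2000 * T + 13 \<le> 2013 * T" by simp
  then show "decides_within w match_program (encode_instance vs es as lab S)
      (2013 * ((card V + card E) * min_max_mu V E + card \<Sigma> * length S)) (has_match V E lab S)"
    unfolding enc card hm[symmetric] T_def[symmetric]
    using Bw runs_main by (intro decides_withinI[where T = "2000 * T"])
      (simp_all add: length_xs xs_header T_def k)
qed

end
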